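(* A point transformation $\Phi$ connects Fokker--Planck equations $\bar{\mathcal F}_{A,B}$ and $\bar{\mathcal F}_{\tilde A,\tilde B}$ if and only if its components are of the form \[ \tilde t=T(t),\quad\tilde x=X(t,x),\quad\tilde u=U^1(t,x)u+U^0(t,x), \] where $T$ and $X$ run through the set of arbitrary functions of their arguments with $T_tX_x\neq0$, $U^1$ is an arbitrary nonzero smooth function of $(t,x)$ such that $X_xU^1$ satisfies the adjoint equation to $\bar{\mathcal F}_{A,B}$, \[ (X_xU^1)_t=-A(X_xU^1)_{xx}+B(X_xU^1)_x, \] and $U^0/U^1$ is an arbitrary solution of $\bar{\mathcal F}_{A,B}$. The arbitrary elements of the target equation are defined by \[ \Phi^*\tilde A=\frac{X_x^2}{T_t}A,\qquad\Phi^*\tilde B=\frac{X_x}{T_t}\left(B-2\frac{U^1_x}{U^1}A\right)-\frac{X_t+3X_{xx}A}{T_t}. \]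
   Context: Everything is real, smooth and local; "nonzero" and $f\neq0$ for a function mean that it vanishes nowhere on its domain. The class $\bar{\mathcal F}$ consists of the Fokker--Planck equations $\bar{\mathcal F}_{A,B}$: $u_t=\big(A(t,x)u\big)_{xx}+\big(B(t,x)u\big)_x$, where $A$ and $B$ are arbitrary smooth functions of $(t,x)$ with $A\neq0$. A point transformation is a local diffeomorphism of the space with coordinates $(t,x,u)$; it connects (maps) the source equation $\bar{\mathcal F}_{A,B}$ to the target equation $\bar{\mathcal F}_{\tilde A,\tilde B}$ if the pushforward of the former by it is the latter. $\Phi^*\tilde A$ denotes $\tilde A(T(t),X(t,x))$, and similarly for $\tilde B$. *)

theory Defs
  imports "HOL-Analysis.Analysis"
begin

text \<open>
  Points of the \<open>(t,x)\<close>-plane are pairs and points of the \<open>(t,x,u)\<close>-space are triples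
  (right-nested pairs). Functions are total; smoothness and equations are only ever required
  on open sets.
\<close>

primrec Ck_on :: "nat \<Rightarrow> 'a::real_normed_vector set \<Rightarrow> ('a \<Rightarrow> 'b::real_normed_vector) \<Rightarrow> bool" where
  "Ck_on 0 S f \<longleftrightarrow> continuous_on S f"
| "Ck_on (Suc k) S f \<longleftrightarrow>
     (\<forall>p\<in>S. f differentiable (at p)) \<and> (\<forall>v. Ck_on k S (\<lambda>p. frechet_derivative f (at p) v))"

text \<open>Derivatives are taken at points of the whole space, so this is meant for open \<open>S\<close> only.\<close>

definition smooth_on :: "'a::real_normed_vector set \<Rightarrow> ('a \<Rightarrow> 'b::real_normed_vector) \<Rightarrow> bool" where
  "smooth_on S f \<longleftrightarrow> (\<forall>k. Ck_on k S f)"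

definition pd_t :: "(real \<times> real \<Rightarrow> real) \<Rightarrow> real \<times> real \<Rightarrow> real" where
  "pd_t f = (\<lambda>(t, x). deriv (\<lambda>s. f (s, x)) t)"

definition pd_x :: "(real \<times> real \<Rightarrow> real) \<Rightarrow> real \<times> real \<Rightarrow> real" where
  "pd_x f = (\<lambda>(t, x). deriv (\<lambda>y. f (t, y)) x)"

definition fp_coefficients ::
  "(real \<times> real) set \<Rightarrow> (real \<times> real \<Rightarrow> real) \<Rightarrow> (real \<times> real \<Rightarrow> real) \<Rightarrow> bool" where
  "fp_coefficients D A B \<longleftrightarrow> open D \<and> smooth_on D A \<and> smooth_on D B \<and> (\<forall>p\<in>D. A p \<noteq> 0)"

text \<open>The equation \<open>u\<^sub>t = (A u)\<^sub>x\<^sub>x + (B u)\<^sub>x\<close> holds for the function \<open>u\<close> at the point \<open>p\<close>.\<close>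

definition fokker_planck_at ::
  "(real \<times> real \<Rightarrow> real) \<Rightarrow> (real \<times> real \<Rightarrow> real) \<Rightarrow> (real \<times> real \<Rightarrow> real) \<Rightarrow> real \<times> real \<Rightarrow> bool" where
  "fokker_planck_at A B u p \<longleftrightarrow>
     pd_t u p = pd_x (pd_x (\<lambda>q. A q * u q)) p + pd_x (\<lambda>q. B q * u q) p"

text \<open>A point transformation with domain \<open>W\<close> is a local diffeomorphism: it is smooth with a smooth
  inverse near every point of \<open>W\<close>, but it need not be injective on all of \<open>W\<close>.\<close>

definition point_transformation ::
  "(real \<times> real \<times> real) set \<Rightarrow> (real \<times> real \<times> real \<Rightarrow> real \<times> real \<times> real) \<Rightarrow> bool" where
  "point_transformation W \<Phi> \<longleftrightarrow> open W \<and>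
     (\<forall>p\<in>W. \<exists>N \<Psi>. open N \<and> p \<in> N \<and> N \<subseteq> W \<and> open (\<Phi> ` N) \<and>
        smooth_on N \<Phi> \<and> smooth_on (\<Phi> ` N) \<Psi> \<and> (\<forall>q\<in>N. \<Psi> (\<Phi> q) = q))"

definition graph_over :: "(real \<times> real) set \<Rightarrow> (real \<times> real \<Rightarrow> real) \<Rightarrow> (real \<times> real \<times> real) set" where
  "graph_over S f = (\<lambda>(t, x). (t, x, f (t, x))) ` S"

text \<open>
  A differential equation is identified with the set of 2-jets of functions satisfying it at a
  point, and \<open>\<Phi>\<close> acts on 2-jets by transforming graphs of functions: if \<open>\<Phi>\<close> maps the graph of \<open>f\<close>
  onto the graph of \<open>g\<close>, then it maps the jet of \<open>f\<close> at \<open>(t,x)\<close> to the jet of \<open>g\<close> at the image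
  point \<open>(t',x')\<close>. The pushforward of the source equation is the target equation iff a jet
  satisfies the former exactly when its image satisfies the latter. Hence the equations are
  compared pointwise and \<open>f\<close> is an arbitrary smooth function, not only a solution. Jets at which
  the image of the graph is not locally a graph are outside the domain of the prolonged
  transformation; for them there is no \<open>g\<close>.
\<close>

definition connects_fokker_planck ::
  "(real \<times> real \<times> real) set \<Rightarrow> (real \<times> real \<times> real \<Rightarrow> real \<times> real \<times> real) \<Rightarrow>
   (real \<times> real \<Rightarrow> real) \<Rightarrow> (real \<times> real \<Rightarrow> real) \<Rightarrow>
   (real \<times> real \<Rightarrow> real) \<Rightarrow> (real \<times> real \<Rightarrow> real) \<Rightarrow> bool" where
  "connects_fokker_planck W \<Phi> A B A' B' \<longleftrightarrow>
     (\<forall>S S' f g. open S \<and> open S' \<and> smooth_on S f \<and> smooth_on S' g \<and>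
        graph_over S f \<subseteq> W \<and> \<Phi> ` graph_over S f = graph_over S' g \<longrightarrow>
        (\<forall>t x t' x' u'. (t, x) \<in> S \<and> \<Phi> (t, x, f (t, x)) = (t', x', u') \<longrightarrow>
           (fokker_planck_at A B f (t, x) \<longleftrightarrow> fokker_planck_at A' B' g (t', x'))))"

definition proj_t :: "(real \<times> real \<times> real) set \<Rightarrow> real set" where
  "proj_t N = (\<lambda>(t, x, u). t) ` N"

definition proj_tx :: "(real \<times> real \<times> real) set \<Rightarrow> (real \<times> real) set" where
  "proj_tx N = (\<lambda>(t, x, u). (t, x)) ` N"

end

theory Submission
  imports Defs
begin

text \<open>
  A function \<open>f\<close> of \<open>(t,x)\<close> whose 1-jets are nondegenerate is carried to a function \<open>g\<close>. If two such functions
  have the same 1-jet at a point, so do their images, and the difference of the Hessians transforms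
  as a quadratic form, up to a nonzero factor. Since \<open>u\<^sub>t\<^sub>t\<close> does not occur in the source equation,
  varying it shows that the total \<open>x\<close>-derivative of \<open>T\<close> vanishes at every nondegenerate 1-jet, so
  \<open>T\<close> depends on \<open>t\<close> only. Varying \<open>u\<^sub>t\<close> and \<open>u\<^sub>x\<^sub>x\<close> together inside the source equation gives
  \<open>A' T\<^sub>t = A (X\<^sub>x + u\<^sub>x X\<^sub>u)\<^sup>2\<close> for all \<open>u\<^sub>x\<close>, so \<open>X\<^sub>u = 0\<close>; then the coefficient of \<open>u\<^sub>x\<^sup>2\<close> gives
  \<open>U\<^sub>u\<^sub>u = 0\<close>.

  For \<open>g (T, X) = U\<^sup>1 f + U\<^sup>0\<close> the equation in divergence form yields
  \<open>T\<^sub>t X\<^sub>x L' g = M (X\<^sub>x (U\<^sup>1 f + U\<^sup>0))\<close>, where \<open>L'\<close> is the target operator and \<open>M\<close> the Fokker-Planck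
  operator with coefficients \<open>A\<close> and \<open>b = (X\<^sub>x\<^sub>x A + T\<^sub>t B' + X\<^sub>t) / X\<^sub>x\<close>. With \<open>\<psi> = X\<^sub>x U\<^sup>1\<close> the right-hand
  side is \<open>\<psi> L f + c1 f\<^sub>x + c0 f + r\<close>, so the equations correspond iff \<open>c1\<close>, \<open>c0\<close> and \<open>r\<close> vanish, and
  these three conditions are the formula for \<open>B'\<close>, the adjoint equation for \<open>\<psi>\<close> and the equation
  for \<open>U\<^sup>0 / U\<^sup>1\<close>.
\<close>

section \<open>Directional derivatives and smoothness\<close>

text \<open>With the direction first, \<open>dird v\<close> is an operator on functions and can be
  iterated; the body is the term whose regularity \<open>Ck_on\<close> demands.\<close>

definition dird :: "'a::real_normed_vector \<Rightarrow> ('a \<Rightarrow> 'b::real_normed_vector) \<Rightarrow> 'a \<Rightarrow> 'b" where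
  "dird v f = (\<lambda>p. frechet_derivative f (at p) v)"

lemma dird_eqI: "(f has_derivative f') (at p) \<Longrightarrow> dird v f p = f' v"
  by (metis dird_def frechet_derivative_at)

lemma has_derivative_dird: "f differentiable (at p) \<Longrightarrow> (f has_derivative (\<lambda>v. dird v f p)) (at p)"
  by (simp add: dird_def frechet_derivative_works[symmetric])

lemma linear_dird: "f differentiable (at p) \<Longrightarrow> linear (\<lambda>v. dird v f p)"
  using has_derivative_dird has_derivative_linear by blast

text \<open>\<open>frechet_derivative\<close> is a choice among the derivatives at \<open>p\<close>,
  so it is enough that \<open>f\<close> and \<open>g\<close> have the same ones; the case where
  there are none is thereby included.\<close>

lemma dird_cong:
  assumes "open S" "p \<in> S" "\<And>q. q \<in> S \<Longrightarrow> f q = g q" 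
  shows "dird v f p = dird v g p"
proof -
  have "(f has_derivative h) (at p) \<longleftrightarrow> (g has_derivative h) (at p)" for h
    using assms has_derivative_transform_within_open[of f h p UNIV S g]
      has_derivative_transform_within_open[of g h p UNIV S f] by auto
  then show ?thesis by (simp add: dird_def frechet_derivative_def)
qed

lemma differentiable_cong_open:
  assumes "open S" "p \<in> S" "\<And>q. q \<in> S \<Longrightarrow> f q = g q" "f differentiable (at p)"
  shows "g differentiable (at p)"
  using assms has_derivative_transform_within_open[of f _ p UNIV S g] unfolding differentiable_def
  by auto

lemma Ck_on_Suc_dird:
  "Ck_on (Suc k) S f \<longleftrightarrow> (\<forall>p\<in>S. f differentiable (at p)) \<and> (\<forall>v. Ck_on k S (dird v f))"
  by (simp add: dird_def)

declare Ck_on.simps(2) [simp del]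

lemma Ck_on_cong:
  assumes "open S" "\<And>q. q \<in> S \<Longrightarrow> f q = g q" "Ck_on k S f"
  shows "Ck_on k S g"
  using assms(2,3)
proof (induction k arbitrary: f g)
  case 0
  then show ?case using continuous_on_cong[OF refl 0(1)] by simp
next
  case (Suc k)
  show ?case unfolding Ck_on_Suc_dird
  proof (intro conjI allI ballI)
    show "g differentiable at p" if "p \<in> S" for p
      by (rule differentiable_cong_open[OF assms(1) that Suc.prems(1)])
        (use Suc.prems(2) that in \<open>simp_all add: Ck_on_Suc_dird\<close>)
    show "Ck_on k S (dird v g)" for v
    proof (rule Suc.IH[of "dird v f"])
      show "dird v f q = dird v g q" if "q \<in> S" for q
        by (rule dird_cong[OF assms(1) that Suc.prems(1)])
    qed (use Suc.prems(2) in \<open>simp add: Ck_on_Suc_dird\<close>)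
  qed
qed

lemma Ck_on_SucD: "Ck_on (Suc k) S f \<Longrightarrow> Ck_on k S f"
proof (induction k arbitrary: f)
  case 0
  then show ?case
    by (auto simp: Ck_on_Suc_dird intro!: continuous_at_imp_continuous_on differentiable_imp_continuous_within)
next
  case (Suc k)
  have "Ck_on k S (dird v f)" for v
    using Suc.IH Suc.prems unfolding Ck_on_Suc_dird[of "Suc k"] by simp
  then show ?case using Suc.prems unfolding Ck_on_Suc_dird by simp
qed

lemma Ck_on_subset: "Ck_on k S f \<Longrightarrow> T \<subseteq> S \<Longrightarrow> Ck_on k T f"
proof (induction k arbitrary: f)
  case 0
  then show ?case by (simp add: continuous_on_subset)
next
  case (Suc k)
  show ?case unfolding Ck_on_Suc_dird
    using Suc.prems Suc.IH[OF _ Suc.prems(2)] by (auto simp: Ck_on_Suc_dird subset_iff)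
qed

lemma Ck_on_locally:
  assumes "\<And>p. p \<in> S \<Longrightarrow> \<exists>N. open N \<and> p \<in> N \<and> Ck_on k N f"
  shows "Ck_on k S f"
  using assms
proof (induction k arbitrary: f)
  case 0
  have "continuous (at p) f" if "p \<in> S" for p
    using 0[OF that] by (auto simp: continuous_on_eq_continuous_at)
  then show ?case by (simp add: continuous_at_imp_continuous_on)
next
  case (Suc k)
  show ?case unfolding Ck_on_Suc_dird
  proof (intro conjI allI ballI)
    show "f differentiable at p" if "p \<in> S" for p
      using Suc.prems[OF that] unfolding Ck_on_Suc_dird by blast
    show "Ck_on k S (dird v f)" for v
    proof (rule Suc.IH)
      show "\<exists>N. open N \<and> p \<in> N \<and> Ck_on k N (dird v f)" if "p \<in> S" for p
        using Suc.prems[OF that] unfolding Ck_on_Suc_dird by blast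
    qed
  qed
qed

text \<open>The standard route to the closure properties below: \<open>f'\<close> is the formula
  supplied by a differentiation rule, and its regularity comes from the induction
  hypothesis.\<close>

lemma Ck_on_SucI:
  assumes "open S" "\<And>p. p \<in> S \<Longrightarrow> (f has_derivative (\<lambda>v. f' v p)) (at p)" "\<And>v. Ck_on k S (f' v)"
  shows "Ck_on (Suc k) S f"
  unfolding Ck_on_Suc_dird
proof (intro conjI allI ballI)
  show "f differentiable at p" if "p \<in> S" for p
    using assms(2)[OF that] by (auto simp: differentiable_def)
  show "Ck_on k S (dird v f)" for v
    by (rule Ck_on_cong[OF assms(1) _ assms(3)]) (simp add: dird_eqI[OF assms(2)])
qed

lemma Ck_on_const: "open S \<Longrightarrow> Ck_on k S (\<lambda>p. c)"
proof (induction k arbitrary: c)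
  case (Suc k)
  show ?case by (rule Ck_on_SucI[where f' = "\<lambda>v p. 0"]) (auto intro: Suc)
qed simp

lemma Ck_on_bounded_linear:
  assumes "bounded_linear L" "open S" "Ck_on k S f"
  shows "Ck_on k S (\<lambda>p. L (f p))"
  using assms(3)
proof (induction k arbitrary: f)
  case 0
  then show ?case using assms(1) by (simp add: bounded_linear.continuous_on)
next
  case (Suc k)
  have d: "f differentiable at p" if "p \<in> S" for p
    using Suc.prems that by (auto simp: Ck_on_Suc_dird)
  show ?case
  proof (rule Ck_on_SucI[where f' = "\<lambda>v p. L (dird v f p)", OF assms(2)])
    show "((\<lambda>p. L (f p)) has_derivative (\<lambda>v. L (dird v f p))) (at p)" if "p \<in> S" for p
      by (rule bounded_linear.has_derivative[OF assms(1) has_derivative_dird[OF d[OF that]]])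
  qed (use Suc in \<open>auto simp: Ck_on_Suc_dird\<close>)
qed

lemma Ck_on_ident: "open S \<Longrightarrow> Ck_on k S (\<lambda>p. p)"
  by (cases k) (simp_all add: Ck_on_SucI[where f' = "\<lambda>v p. v"] Ck_on_const)

lemma Ck_on_add:
  assumes "open S" "Ck_on k S f" "Ck_on k S g"
  shows "Ck_on k S (\<lambda>p. f p + g p)"
  using assms(2,3)
proof (induction k arbitrary: f g)
  case 0
  then show ?case by (simp add: continuous_on_add)
next
  case (Suc k)
  show ?case
    using Suc.prems
    by (intro Ck_on_SucI[where f' = "\<lambda>v p. dird v f p + dird v g p", OF assms(1)]
        has_derivative_add has_derivative_dird Suc.IH)
      (simp_all add: Ck_on_Suc_dird)
qed

lemma Ck_on_sum:
  assumes "open S" "finite I" "\<And>i. i \<in> I \<Longrightarrow> Ck_on k S (f i)"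
  shows "Ck_on k S (\<lambda>p. \<Sum>i\<in>I. f i p)"
  using assms(2,3) by (induction I) (auto intro: Ck_on_const Ck_on_add assms(1))

text \<open>The product rule leaves undifferentiated factors in the derivative, so these are first
  lowered from C^(k+1) to C^k. Bilinear maps cover both multiplication of reals and the scaling in
  the chain rule.\<close>

lemma (in bounded_bilinear) Ck_on:
  assumes "open S" "Ck_on k S f" "Ck_on k S g"
  shows "Ck_on k S (\<lambda>p. prod (f p) (g p))"
  using assms(2,3)
proof (induction k arbitrary: f g)
  case 0
  then show ?case by (simp add: continuous_on)
next
  case (Suc k)
  show ?case
    using Suc.prems Ck_on_SucD[OF Suc.prems(1)] Ck_on_SucD[OF Suc.prems(2)]
    by (intro Ck_on_SucI[where f' = "\<lambda>v p. prod (f p) (dird v g p) + prod (dird v f p) (g p)", OF assms(1)]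
        FDERIV has_derivative_dird Ck_on_add Suc.IH assms(1))
      (simp_all add: Ck_on_Suc_dird)
qed

lemma Ck_on_Pair:
  assumes "open S" "Ck_on k S f" "Ck_on k S g"
  shows "Ck_on k S (\<lambda>p. (f p, g p))"
  using assms(2,3)
proof (induction k arbitrary: f g)
  case 0
  then show ?case by (simp add: continuous_on_Pair)
next
  case (Suc k)
  show ?case
    using Suc.prems
    by (intro Ck_on_SucI[where f' = "\<lambda>v p. (dird v f p, dird v g p)", OF assms(1)]
        has_derivative_Pair has_derivative_dird Suc.IH)
      (simp_all add: Ck_on_Suc_dird)
qed

lemma dird_euclidean:
  fixes f :: "'a::euclidean_space \<Rightarrow> 'b::real_normed_vector"
  assumes "f differentiable at p"
  shows "dird w f p = (\<Sum>b\<in>Basis. (w \<bullet> b) *\<^sub>R dird b f p)"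
proof -
  have "dird (\<Sum>b\<in>Basis. (w \<bullet> b) *\<^sub>R b) f p = (\<Sum>b\<in>Basis. (w \<bullet> b) *\<^sub>R dird b f p)"
    by (simp add: linear_sum[OF linear_dird[OF assms]] linear_scale[OF linear_dird[OF assms]])
  then show ?thesis unfolding euclidean_representation .
qed

lemma has_derivative_comp_dird:
  assumes "g differentiable at p" "f differentiable at (g p)"
  shows "((\<lambda>p. f (g p)) has_derivative (\<lambda>v. dird (dird v g p) f (g p))) (at p)"
  using diff_chain_at[OF has_derivative_dird[OF assms(1)] has_derivative_dird[OF assms(2)]]
  by (simp add: o_def)

lemma dird_comp:
  assumes "g differentiable at p" "f differentiable at (g p)"
  shows "dird v (\<lambda>p. f (g p)) p = dird (dird v g p) f (g p)"
  by (rule dird_eqI[OF has_derivative_comp_dird[OF assms]])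

text \<open>In the chain rule the direction in which \<open>f\<close> is differentiated varies with
  \<open>p\<close>. Expanding it over \<open>Basis\<close> leaves a finite sum of products in which
  each derivative of \<open>f\<close> has a fixed direction, so the induction hypothesis
  applies.\<close>

lemma Ck_on_comp:
  fixes f :: "'b::euclidean_space \<Rightarrow> 'c::real_normed_vector"
  assumes "open S" "open T" "g ` S \<subseteq> T" "Ck_on k T f" "Ck_on k S g"
  shows "Ck_on k S (\<lambda>p. f (g p))"
  using assms(4,5)
proof (induction k arbitrary: f)
  case 0
  then show ?case
    using continuous_on_compose2[of T f S g] assms(3) by simp
next
  case (Suc k)
  have g: "Ck_on k S g" "\<And>v. Ck_on k S (dird v g)" "\<And>p. p \<in> S \<Longrightarrow> g differentiable at p"
    using Ck_on_SucD[OF Suc.prems(2)] Suc.prems(2) by (simp_all add: Ck_on_Suc_dird)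
  have f: "\<And>v. Ck_on k T (dird v f)" "\<And>p. p \<in> T \<Longrightarrow> f differentiable at p"
    using Suc.prems(1) by (simp_all add: Ck_on_Suc_dird)
  show ?case
  proof (rule Ck_on_SucI[OF assms(1)])
    show "((\<lambda>p. f (g p)) has_derivative (\<lambda>v. \<Sum>b\<in>Basis. (dird v g p \<bullet> b) *\<^sub>R dird b f (g p))) (at p)"
      if "p \<in> S" for p
      unfolding dird_euclidean[OF f(2), OF subsetD[OF assms(3) imageI[OF that]], symmetric]
      using assms(3) that by (intro has_derivative_comp_dird g(3) f(2)) auto
    show "Ck_on k S (\<lambda>p. \<Sum>b\<in>Basis. (dird v g p \<bullet> b) *\<^sub>R dird b f (g p))" for v
    proof (rule Ck_on_sum[OF assms(1) finite_Basis])
      fix b :: 'b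
      show "Ck_on k S (\<lambda>p. (dird v g p \<bullet> b) *\<^sub>R dird b f (g p))"
        by (rule bounded_bilinear.Ck_on[OF bounded_bilinear_scaleR assms(1)
            Ck_on_bounded_linear[OF bounded_linear_inner_left assms(1) g(2)] Suc.IH[OF f(1) g(1)]])
    qed
  qed
qed

text \<open>The derivative of the inverse is a polynomial in the inverse itself, so regularity of
  order \<open>k\<close> passes to order \<open>k + 1\<close>.\<close>

lemma Ck_on_inverse_real: "Ck_on k {x::real. x \<noteq> 0} inverse"
proof (induction k)
  case 0
  then show ?case by (auto intro!: continuous_intros)
next
  case (Suc k)
  have o: "open {x::real. x \<noteq> 0}" by (simp add: open_Collect_neq)
  show ?case
  proof (rule Ck_on_SucI[OF o])
    show "(inverse has_derivative (\<lambda>v. - (inverse p * v * inverse p))) (at p)" if "p \<in> {x. x \<noteq> 0}" for p :: real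
      using that by (intro has_derivative_inverse') simp
    show "Ck_on k {x::real. x \<noteq> 0} (\<lambda>p. - (inverse p * v * inverse p))" for v
      by (rule Ck_on_bounded_linear[OF bounded_linear_minus[OF bounded_linear_ident] o
          bounded_bilinear.Ck_on[OF bounded_bilinear_mult o
            bounded_bilinear.Ck_on[OF bounded_bilinear_mult o Suc Ck_on_const[OF o]] Suc]])
  qed
qed

section \<open>Smooth functions and rules of differentiation\<close>

named_theorems smooth_intros

lemma smooth_onD: "smooth_on S f \<Longrightarrow> Ck_on k S f"
  by (simp add: smooth_on_def)

lemma smooth_onI: "(\<And>k. Ck_on k S f) \<Longrightarrow> smooth_on S f"
  by (simp add: smooth_on_def)

lemma smooth_on_cong: "open S \<Longrightarrow> (\<And>q. q \<in> S \<Longrightarrow> f q = g q) \<Longrightarrow> smooth_on S f \<Longrightarrow> smooth_on S g"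
  by (rule smooth_onI, rule Ck_on_cong[of S f g]) (assumption | rule smooth_onD)+

lemma smooth_on_subset: "smooth_on S f \<Longrightarrow> T \<subseteq> S \<Longrightarrow> smooth_on T f"
  by (rule smooth_onI, rule Ck_on_subset) (rule smooth_onD)

lemma smooth_on_locally:
  assumes "\<And>p. p \<in> S \<Longrightarrow> \<exists>N. open N \<and> p \<in> N \<and> smooth_on N f"
  shows "smooth_on S f"
  unfolding smooth_on_def
proof (intro allI Ck_on_locally)
  show "\<exists>N. open N \<and> p \<in> N \<and> Ck_on k N f" if "p \<in> S" for p k
    using assms[OF that] by (auto simp: smooth_on_def)
qed

lemma smooth_on_dird [smooth_intros]: "smooth_on S f \<Longrightarrow> smooth_on S (dird v f)"
  by (rule smooth_onI) (use smooth_onD[of S f "Suc _"] in \<open>simp add: Ck_on_Suc_dird\<close>)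

lemma smooth_on_differentiable: "smooth_on S f \<Longrightarrow> p \<in> S \<Longrightarrow> f differentiable (at p)"
  using smooth_onD[of S f "Suc 0"] by (simp add: Ck_on_Suc_dird)

lemma smooth_on_continuous: "smooth_on S f \<Longrightarrow> continuous_on S f"
  using smooth_onD[of S f 0] by simp

lemma smooth_on_const [smooth_intros]: "open S \<Longrightarrow> smooth_on S (\<lambda>p. c)"
  by (simp add: smooth_on_def Ck_on_const)

lemma smooth_on_ident [smooth_intros]: "open S \<Longrightarrow> smooth_on S (\<lambda>p. p)"
  by (simp add: smooth_on_def Ck_on_ident)

lemma smooth_on_bounded_linear:
  "bounded_linear L \<Longrightarrow> open S \<Longrightarrow> smooth_on S f \<Longrightarrow> smooth_on S (\<lambda>p. L (f p))"
  by (simp add: smooth_on_def Ck_on_bounded_linear)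

lemmas smooth_on_fst [smooth_intros] = smooth_on_bounded_linear[OF bounded_linear_fst]
  and smooth_on_snd [smooth_intros] = smooth_on_bounded_linear[OF bounded_linear_snd]
  and smooth_on_minus [smooth_intros] = smooth_on_bounded_linear[OF bounded_linear_minus[OF bounded_linear_ident]]

lemma smooth_on_add [smooth_intros]:
  "open S \<Longrightarrow> smooth_on S f \<Longrightarrow> smooth_on S g \<Longrightarrow> smooth_on S (\<lambda>p. f p + g p)"
  by (simp add: smooth_on_def Ck_on_add)

lemma smooth_on_diff [smooth_intros]:
  "open S \<Longrightarrow> smooth_on S f \<Longrightarrow> smooth_on S g \<Longrightarrow> smooth_on S (\<lambda>p. f p - g p)"
  using smooth_on_add[OF _ _ smooth_on_minus, of S f g] by simp

lemma smooth_on_mult [smooth_intros]: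
  fixes f g :: "'a::real_normed_vector \<Rightarrow> real"
  shows "open S \<Longrightarrow> smooth_on S f \<Longrightarrow> smooth_on S g \<Longrightarrow> smooth_on S (\<lambda>p. f p * g p)"
  by (simp add: smooth_on_def bounded_bilinear.Ck_on[OF bounded_bilinear_mult])

lemma smooth_on_power [smooth_intros]:
  fixes f :: "'a::real_normed_vector \<Rightarrow> real"
  shows "open S \<Longrightarrow> smooth_on S f \<Longrightarrow> smooth_on S (\<lambda>p. f p ^ n)"
  by (induction n) (simp_all add: smooth_on_const smooth_on_mult)

lemma smooth_on_Pair [smooth_intros]:
  "open S \<Longrightarrow> smooth_on S f \<Longrightarrow> smooth_on S g \<Longrightarrow> smooth_on S (\<lambda>p. (f p, g p))"
  by (simp add: smooth_on_def Ck_on_Pair)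

lemma smooth_on_comp:
  fixes f :: "'b::euclidean_space \<Rightarrow> 'c::real_normed_vector"
  shows "open S \<Longrightarrow> open T \<Longrightarrow> g ` S \<subseteq> T \<Longrightarrow> smooth_on T f \<Longrightarrow> smooth_on S g \<Longrightarrow> smooth_on S (\<lambda>p. f (g p))"
  by (simp add: smooth_on_def Ck_on_comp[of S T g])

lemma smooth_on_divide [smooth_intros]:
  fixes f g :: "'a::real_normed_vector \<Rightarrow> real"
  assumes "open S" "smooth_on S f" "smooth_on S g" "\<And>p. p \<in> S \<Longrightarrow> g p \<noteq> 0"
  shows "smooth_on S (\<lambda>p. f p / g p)"
proof -
  have "smooth_on S (\<lambda>p. inverse (g p))"
  proof (rule smooth_on_comp[OF assms(1) _ _ _ assms(3)])
    show "open {x::real. x \<noteq> 0}" by (simp add: open_Collect_neq)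
    show "smooth_on {x::real. x \<noteq> 0} inverse" by (simp add: smooth_on_def Ck_on_inverse_real)
  qed (use assms(4) in auto)
  from smooth_on_mult[OF assms(1,2) this] show ?thesis by (simp add: divide_inverse)
qed

lemma dird_add: "f differentiable at p \<Longrightarrow> g differentiable at p \<Longrightarrow>
  dird v (\<lambda>q. f q + g q) p = dird v f p + dird v g p"
  by (rule dird_eqI[OF has_derivative_add[OF has_derivative_dird has_derivative_dird]])

lemma dird_diff: "f differentiable at p \<Longrightarrow> g differentiable at p \<Longrightarrow>
  dird v (\<lambda>q. f q - g q) p = dird v f p - dird v g p"
  by (rule dird_eqI[OF has_derivative_diff[OF has_derivative_dird has_derivative_dird]])

lemma dird_mult:
  fixes f g :: "'a::real_normed_vector \<Rightarrow> real"
  shows "f differentiable at p \<Longrightarrow> g differentiable at p \<Longrightarrow>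
  dird v (\<lambda>q. f q * g q) p = f p * dird v g p + dird v f p * g p"
  by (rule dird_eqI[OF has_derivative_mult[OF has_derivative_dird has_derivative_dird]])

lemma dird_const: "dird v (\<lambda>q. c) p = 0"
  by (simp add: dird_def)

lemma dird_Pair: "f differentiable at p \<Longrightarrow> g differentiable at p \<Longrightarrow>
  dird v (\<lambda>q. (f q, g q)) p = (dird v f p, dird v g p)"
  by (rule dird_eqI[OF has_derivative_Pair[OF has_derivative_dird has_derivative_dird]])

lemma dird_bounded_linear: "bounded_linear L \<Longrightarrow> f differentiable at p \<Longrightarrow>
  dird v (\<lambda>q. L (f q)) p = L (dird v f p)"
  by (rule dird_eqI[OF bounded_linear.has_derivative[OF _ has_derivative_dird]])

lemma dird_linear_id: "bounded_linear L \<Longrightarrow> dird v L p = L v"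
  by (rule dird_eqI[OF bounded_linear_imp_has_derivative])

section \<open>Mixed derivatives, descent along projections, local inverses\<close>

lemma has_real_derivative_line:
  fixes f :: "'a::real_normed_vector \<Rightarrow> real"
  assumes "f differentiable at (p + s *\<^sub>R v)"
  shows "((\<lambda>s. f (p + s *\<^sub>R v)) has_real_derivative dird v f (p + s *\<^sub>R v)) (at s)"
proof -
  have "((\<lambda>s. p + s *\<^sub>R v) has_derivative (\<lambda>h. h *\<^sub>R v)) (at s)"
    by (auto intro!: derivative_eq_intros)
  from diff_chain_at[OF this has_derivative_dird[OF assms]]
  have "((\<lambda>s. f (p + s *\<^sub>R v)) has_derivative (\<lambda>h. dird (h *\<^sub>R v) f (p + s *\<^sub>R v))) (at s)"
    by (simp only: o_def)
  moreover have "(\<lambda>h. dird (h *\<^sub>R v) f (p + s *\<^sub>R v)) = (*) (dird v f (p + s *\<^sub>R v))"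
    by (rule ext) (simp add: linear_scale[OF linear_dird[OF assms]])
  ultimately show ?thesis
    by (simp only: has_field_derivative_def)
qed

text \<open>The mean value theorem is applied twice: along \<open>v\<close> to the increment of
  \<open>f\<close> in direction \<open>w\<close>, then along \<open>w\<close> to
  \<open>dird v f\<close>.\<close>

lemma second_difference_mean_value:
  fixes f :: "'a::real_normed_vector \<Rightarrow> real"
  assumes "smooth_on S f" "h > 0"
    and S: "\<And>s r. 0 \<le> s \<Longrightarrow> s \<le> h \<Longrightarrow> 0 \<le> r \<Longrightarrow> r \<le> h \<Longrightarrow> p + s *\<^sub>R v + r *\<^sub>R w \<in> S"
  obtains s r where "0 < s" "s < h" "0 < r" "r < h"
    "f (p + h *\<^sub>R v + h *\<^sub>R w) - f (p + h *\<^sub>R v) - f (p + h *\<^sub>R w) + f p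
      = h * (h * dird w (dird v f) (p + s *\<^sub>R v + r *\<^sub>R w))"
proof -
  define \<phi> where "\<phi> s = f (p + h *\<^sub>R w + s *\<^sub>R v) - f (p + s *\<^sub>R v)" for s
  have "(\<phi> has_real_derivative dird v f (p + h *\<^sub>R w + s *\<^sub>R v) - dird v f (p + s *\<^sub>R v)) (at s)"
    if "0 \<le> s" "s \<le> h" for s
    unfolding \<phi>_def using S[of s h] S[of s 0] that assms(1,2)
    by (intro DERIV_diff has_real_derivative_line smooth_on_differentiable[OF assms(1)])
      (simp_all add: add_ac)
  from MVT2[OF assms(2) this] obtain s where s: "0 < s" "s < h"
    and 1: "\<phi> h - \<phi> 0 = (h - 0) * (dird v f (p + h *\<^sub>R w + s *\<^sub>R v) - dird v f (p + s *\<^sub>R v))"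
    by blast
  have "((\<lambda>r. dird v f (p + s *\<^sub>R v + r *\<^sub>R w)) has_real_derivative
      dird w (dird v f) (p + s *\<^sub>R v + r *\<^sub>R w)) (at r)"
    if "0 \<le> r" "r \<le> h" for r
    using S[of s r] that s
    by (intro has_real_derivative_line smooth_on_differentiable[OF smooth_on_dird[OF assms(1)]]) simp
  from MVT2[OF assms(2) this] obtain r where r: "0 < r" "r < h"
    and 2: "dird v f (p + s *\<^sub>R v + h *\<^sub>R w) - dird v f (p + s *\<^sub>R v + 0 *\<^sub>R w)
      = (h - 0) * dird w (dird v f) (p + s *\<^sub>R v + r *\<^sub>R w)"
    by blast
  show thesis
    using 1 2 by (intro that[OF s r]) (simp add: \<phi>_def add_ac)
qed

text \<open>The second difference of \<open>f\<close> is symmetric in \<open>v\<close> and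
  \<open>w\<close>, and it equals \<open>h * h\<close> times either mixed derivative at some point
  near \<open>p\<close>. Were the two values at \<open>p\<close> different, continuity would keep
  them apart.\<close>

lemma dird_commute:
  fixes f :: "'a::real_normed_vector \<Rightarrow> real"
  assumes "open S" "smooth_on S f" "p \<in> S"
  shows "dird v (dird w f) p = dird w (dird v f) p"
proof (rule ccontr)
  define G H where "G = dird w (dird v f)" and "H = dird v (dird w f)"
  assume "dird v (dird w f) p \<noteq> dird w (dird v f) p"
  then have e: "\<bar>G p - H p\<bar> / 2 > 0" by (simp add: G_def H_def)
  have "isCont G p" "isCont H p"
    using assms smooth_on_continuous[OF smooth_on_dird[OF smooth_on_dird[OF assms(2)]]]
    by (simp_all add: G_def H_def continuous_on_eq_continuous_at)
  obtain d1 where d1: "d1 > 0" "\<And>q. dist q p < d1 \<Longrightarrow> dist (G q) (G p) < \<bar>G p - H p\<bar> / 2"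
    using \<open>isCont G p\<close>[unfolded continuous_at_eps_delta, rule_format, OF e] by blast
  obtain d2 where d2: "d2 > 0" "\<And>q. dist q p < d2 \<Longrightarrow> dist (H q) (H p) < \<bar>G p - H p\<bar> / 2"
    using \<open>isCont H p\<close>[unfolded continuous_at_eps_delta, rule_format, OF e] by blast
  note d12 = d1 d2
  obtain d3 where d3: "d3 > 0" "\<And>q. dist q p < d3 \<Longrightarrow> q \<in> S"
    using assms(1,3) by (auto simp: open_dist)
  define d where "d = min d1 (min d2 d3)"
  \<comment> \<open>With this step the whole parallelogram lies within distance \<open>d\<close> of
    \<open>p\<close>; the summand 1 keeps the denominator positive when \<open>v\<close> and
    \<open>w\<close> are zero.\<close>
  define h where "h = d / (norm v + norm w + 1)"
  have d: "d > 0" using d12 d3 by (simp add: d_def)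
  have n: "norm v + norm w + 1 > 0" by (simp add: add_nonneg_pos)
  have h: "h > 0" unfolding h_def using d n by simp
  have near: "dist (p + s *\<^sub>R v + r *\<^sub>R w) p < d" if "0 \<le> s" "s \<le> h" "0 \<le> r" "r \<le> h" for s r
  proof -
    have "dist (p + s *\<^sub>R v + r *\<^sub>R w) p = norm (s *\<^sub>R v + r *\<^sub>R w)"
      by (simp add: dist_norm add.assoc)
    also have "\<dots> \<le> s * norm v + r * norm w"
      using norm_triangle_ineq[of "s *\<^sub>R v" "r *\<^sub>R w"] that by simp
    also have "\<dots> \<le> h * norm v + h * norm w"
      using that by (intro add_mono mult_right_mono) auto
    also have "\<dots> < h * (norm v + norm w + 1)" using h by (simp add: algebra_simps)
    also have "\<dots> = d" using n by (simp add: h_def)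
    finally show ?thesis .
  qed
  have near': "dist (p + s *\<^sub>R w + r *\<^sub>R v) p < d" if "0 \<le> s" "s \<le> h" "0 \<le> r" "r \<le> h" for s r
    using near[of r s] that by (simp add: add_ac)
  obtain s r where sr: "0 < s" "s < h" "0 < r" "r < h"
    "f (p + h *\<^sub>R v + h *\<^sub>R w) - f (p + h *\<^sub>R v) - f (p + h *\<^sub>R w) + f p
      = h * (h * G (p + s *\<^sub>R v + r *\<^sub>R w))"
    unfolding G_def
    by (rule second_difference_mean_value[OF assms(2) h, of p v w]) (use near d3(2) in \<open>auto simp: d_def\<close>)
  obtain s' r' where sr': "0 < s'" "s' < h" "0 < r'" "r' < h"
    "f (p + h *\<^sub>R w + h *\<^sub>R v) - f (p + h *\<^sub>R w) - f (p + h *\<^sub>R v) + f p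
      = h * (h * H (p + s' *\<^sub>R w + r' *\<^sub>R v))"
    unfolding H_def
    by (rule second_difference_mean_value[OF assms(2) h, of p w v]) (use near' d3(2) in \<open>auto simp: d_def\<close>)
  have "f (p + h *\<^sub>R w + h *\<^sub>R v) = f (p + h *\<^sub>R v + h *\<^sub>R w)"
    by (simp add: add_ac)
  then have "h * (h * G (p + s *\<^sub>R v + r *\<^sub>R w)) = h * (h * H (p + s' *\<^sub>R w + r' *\<^sub>R v))"
    using sr(5) sr'(5) by linarith
  then have "G (p + s *\<^sub>R v + r *\<^sub>R w) = H (p + s' *\<^sub>R w + r' *\<^sub>R v)"
    using h by simp
  moreover have "dist (G (p + s *\<^sub>R v + r *\<^sub>R w)) (G p) < \<bar>G p - H p\<bar> / 2"
    using near[of s r] sr by (intro d1) (simp add: d_def)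
  moreover have "dist (H (p + s' *\<^sub>R w + r' *\<^sub>R v)) (H p) < \<bar>G p - H p\<bar> / 2"
    using near'[of s' r'] sr' by (intro d2) (simp add: d_def)
  ultimately show False
    by (simp add: dist_real_def abs_if field_simps split: if_splits)
qed

section \<open>Descent of functions along linear projections\<close>

lemma constant_along_kernel:
  fixes h :: "'a::real_normed_vector \<Rightarrow> real"
  assumes "convex N" "smooth_on N h" "p \<in> N" "q \<in> N"
    and "\<And>r. r \<in> N \<Longrightarrow> dird (q - p) h r = 0"
  shows "h p = h q"
proof -
  have N: "p + s *\<^sub>R (q - p) \<in> N" if "0 \<le> s" "s \<le> 1" for s
    using convexD_alt[OF assms(1,3,4) that] by (simp add: algebra_simps)
  have "((\<lambda>s. h (p + s *\<^sub>R (q - p))) has_real_derivative 0) (at s)" if "0 \<le> s" "s \<le> 1" for s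
    using has_real_derivative_line[OF smooth_on_differentiable[OF assms(2) N[OF that]]]
      assms(5)[OF N[OF that]] by simp
  from MVT2[OF zero_less_one this] show ?thesis by auto
qed

text \<open>Points of one fibre of \<open>\<pi>\<close> in the convex set \<open>N\<close> are
  joined by a segment along which \<open>h\<close> has zero derivative, so \<open>h\<close> is
  constant on each fibre and any choice of preimage defines the same \<open>k\<close>.\<close>

lemma smooth_descend:
  fixes h :: "'a::euclidean_space \<Rightarrow> real" and \<pi> :: "'a \<Rightarrow> 'b::euclidean_space"
  assumes lin: "bounded_linear \<pi>" "bounded_linear \<sigma>" and \<pi>\<sigma>: "\<And>y. \<pi> (\<sigma> y) = y"
    and N: "open N" "convex N" and h: "smooth_on N h"
    and 0: "\<And>p v. p \<in> N \<Longrightarrow> \<pi> v = 0 \<Longrightarrow> dird v h p = 0"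
  obtains k where "smooth_on (\<pi> ` N) k" "\<And>p. p \<in> N \<Longrightarrow> h p = k (\<pi> p)"
proof -
  define k where "k y = h (SOME p. p \<in> N \<and> \<pi> p = y)" for y
  have k: "h p = k (\<pi> p)" if "p \<in> N" for p
  proof -
    define q where "q = (SOME q. q \<in> N \<and> \<pi> q = \<pi> p)"
    have "q \<in> N \<and> \<pi> q = \<pi> p" unfolding q_def by (rule someI[of _ p]) (simp add: that)
    then have "h p = h q"
      using that lin(1) by (intro constant_along_kernel[OF N(2) h] 0)
        (auto simp: bounded_linear.linear linear_diff)
    then show ?thesis by (simp add: k_def q_def)
  qed
  moreover have "smooth_on (\<pi> ` N) k"
  proof (rule smooth_on_locally)
    fix y assume "y \<in> \<pi> ` N"
    then obtain p where p: "p \<in> N" "y = \<pi> p" by blast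
    \<comment> \<open>An affine section of \<open>\<pi>\<close> through \<open>p\<close>. Near
      \<open>y\<close> it stays in \<open>N\<close>, so there \<open>k\<close> is the smooth
      function \<open>h\<close> composed with it.\<close>
    define c where "c = (\<lambda>z. p + \<sigma> (z - y))"
    have sc: "smooth_on U c" if "open U" for U
      unfolding c_def
      by (intro smooth_intros smooth_on_bounded_linear[OF lin(2)] that)
    have \<pi>c: "\<pi> (c z) = z" for z
      using \<pi>\<sigma> p(2) bounded_linear.linear[OF lin(1)] by (simp add: c_def linear_add)
    define U where "U = c -` N"
    have "open U"
      unfolding U_def using N(1) smooth_on_continuous[OF sc[OF open_UNIV]] by (simp add: open_vimage)
    moreover have "y \<in> U"
      using p bounded_linear.linear[OF lin(2)] by (simp add: U_def c_def linear_0)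
    moreover have "smooth_on U k"
    proof (rule smooth_on_cong[OF \<open>open U\<close>])
      show "smooth_on U (\<lambda>z. h (c z))"
        by (rule smooth_on_comp[OF \<open>open U\<close> N(1) _ h sc[OF \<open>open U\<close>]]) (auto simp: U_def)
      show "h (c z) = k z" if "z \<in> U" for z
        using k[of "c z"] that \<pi>c by (simp add: U_def)
    qed
    ultimately show "\<exists>M. open M \<and> y \<in> M \<and> smooth_on M k" by blast
  qed
  ultimately show thesis using that by blast
qed

section \<open>Smooth local inverses in the plane\<close>

abbreviation Dt :: "(real \<times> real \<Rightarrow> real) \<Rightarrow> real \<times> real \<Rightarrow> real" where "Dt \<equiv> dird (1, 0)"
abbreviation Dx :: "(real \<times> real \<Rightarrow> real) \<Rightarrow> real \<times> real \<Rightarrow> real" where "Dx \<equiv> dird (0, 1)"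

lemma dird_plane:
  fixes f :: "real \<times> real \<Rightarrow> real"
  assumes "f differentiable at p"
  shows "dird (a, b) f p = a * Dt f p + b * Dx f p"
proof -
  have "dird (a *\<^sub>R (1, 0) + b *\<^sub>R (0, 1)) f p = a * Dt f p + b * Dx f p"
    by (simp only: linear_add[OF linear_dird[OF assms]] linear_scale[OF linear_dird[OF assms]]) simp
  then show ?thesis by simp
qed

text \<open>The inverse \<open>k\<close> has derivative \<open>c v (k y)\<close> with
  \<open>c\<close> smooth, so if \<open>k\<close> is C^n then its derivative is too and
  \<open>k\<close> is C^(n+1). Starting from continuity, this bootstrap gives smoothness.\<close>

lemma smooth_local_inverse_plane:
  fixes P Q :: "real \<times> real \<Rightarrow> real"
  assumes S0: "open S0" "smooth_on S0 P" "smooth_on S0 Q" "q0 \<in> S0"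
    and J: "Dt P q0 * Dx Q q0 - Dx P q0 * Dt Q q0 \<noteq> 0"
  obtains S V k where "open S" "open V" "q0 \<in> S" "S \<subseteq> S0" "(\<lambda>q. (P q, Q q)) ` S = V"
    "smooth_on V k" "\<And>q. q \<in> S \<Longrightarrow> k (P q, Q q) = q" "\<And>y. y \<in> V \<Longrightarrow> k y \<in> S"
proof -
  define j where "j q = Dt P q * Dx Q q - Dx P q * Dt Q q" for q
  define h where "h q = (P q, Q q)" for q
  have sj: "smooth_on S0 j" unfolding j_def by (intro smooth_intros S0)
  \<comment> \<open>Shrinking to the points with nonzero Jacobian determinant makes the derivative
    invertible throughout.\<close>
  define S1 where "S1 = S0 \<inter> j -` (- {0})"
  have S1: "open S1" "q0 \<in> S1" "S1 \<subseteq> S0" "\<And>q. q \<in> S1 \<Longrightarrow> j q \<noteq> 0"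
    using S0 J continuous_open_preimage[OF smooth_on_continuous[OF sj] S0(1), of "- {0}"]
    by (auto simp: S1_def j_def)
  have sm: "smooth_on S1 P" "smooth_on S1 Q" "smooth_on S1 j"
    using S0 S1 sj smooth_on_subset by blast+
  have df: "P differentiable at q" "Q differentiable at q" if "q \<in> S1" for q
    using sm that smooth_on_differentiable by blast+
  define f' where "f' q v = (dird v P q, dird v Q q)" for q v
  have der: "(h has_derivative f' q) (at q)" if "q \<in> S1" for q
    unfolding h_def f'_def by (intro has_derivative_Pair has_derivative_dird df that)
  have bl: "bounded_linear (f' q)" if "q \<in> S1" for q
    using der[OF that] by (rule has_derivative_bounded_linear)
  have app: "blinfun_apply (Blinfun (f' q)) = f' q" if "q \<in> S1" for q
    by (rule bounded_linear_Blinfun_apply[OF bl[OF that]])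
  \<comment> \<open>Cramer's rule for the inverse of \<open>f' q\<close>.\<close>
  define c where "c v q = ((fst v * Dx Q q - snd v * Dx P q) / j q, (snd v * Dt P q - fst v * Dt Q q) / j q)"
    for v q
  have f': "f' q v = (fst v * Dt P q + snd v * Dx P q, fst v * Dt Q q + snd v * Dx Q q)" if "q \<in> S1" for q v
    using dird_plane[OF df(1)[OF that], of "fst v" "snd v"] dird_plane[OF df(2)[OF that], of "fst v" "snd v"]
    by (simp add: f'_def)
  have cf: "c (f' q v) q = v" if "q \<in> S1" for q v
    using S1(4)[OF that] by (cases v) (simp add: c_def f'[OF that] field_simps, simp add: j_def algebra_simps)
  have fc: "f' q (c v q) = v" if "q \<in> S1" for q v
    using S1(4)[OF that] by (cases v) (simp add: c_def f'[OF that] field_simps, simp add: j_def algebra_simps)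
  have contf: "continuous_on S1 (\<lambda>q. Blinfun (f' q))"
  proof (rule continuous_on_blinfun_componentwise)
    fix i :: "real \<times> real"
    have "continuous_on S1 (\<lambda>q. f' q i)"
      unfolding f'_def by (intro continuous_on_Pair smooth_on_continuous smooth_intros sm)
    then show "continuous_on S1 (\<lambda>q. blinfun_apply (Blinfun (f' q)) i)"
      using continuous_on_cong[OF refl, of S1 "\<lambda>q. blinfun_apply (Blinfun (f' q)) i" "\<lambda>q. f' q i"] app by simp
  qed
  have "(\<lambda>v. c v q0) = inv (f' q0)"
    using cf[OF S1(2)] fc[OF S1(2)] by (metis inv_equality)
  have blc: "bounded_linear (\<lambda>v. c v q0)"
    unfolding c_def
    by (simp add: linear_conv_bounded_linear[symmetric] linear_iff algebra_simps add_divide_distrib diff_divide_distrib)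
  have inv0: "Blinfun (\<lambda>v. c v q0) o\<^sub>L Blinfun (f' q0) = id_blinfun"
    by (rule blinfun_eqI) (simp add: bounded_linear_Blinfun_apply[OF blc] app[OF S1(2)] cf[OF S1(2)])
  obtain S V k g' where *: "open S" "S \<subseteq> S1" "q0 \<in> S" "open V" "h q0 \<in> V" "homeomorphism S V h k"
    "\<And>y. y \<in> V \<Longrightarrow> (k has_derivative (g' y)) (at y)"
    "\<And>y. y \<in> V \<Longrightarrow> g' y = inv (blinfun_apply (Blinfun (f' (k y))))"
    by (rule inverse_function_theorem[OF S1(1) _ contf S1(2) inv0, of h]) (use der app in auto)
  have kV: "k y \<in> S" if "y \<in> V" for y using *(6) that by (auto simp: homeomorphism_def)
  have g': "g' y = (\<lambda>v. c v (k y))" if "y \<in> V" for y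
  proof -
    have "k y \<in> S1" using kV[OF that] *(2) by blast
    then have "inv (f' (k y)) = (\<lambda>v. c v (k y))"
      by (intro inv_equality cf fc)
    then show ?thesis using *(8)[OF that] app[OF \<open>k y \<in> S1\<close>] by simp
  qed
  have sc: "smooth_on S1 (c v)" for v
    unfolding c_def[abs_def] by (intro smooth_intros sm S1(1)) (use S1(4) in auto)
  have "Ck_on n V k" for n
  proof (induction n)
    case 0
    have "continuous_on V k" using *(6) by (simp add: homeomorphism_def)
    then show ?case by simp
  next
    case (Suc n)
    show ?case
    proof (rule Ck_on_SucI[OF *(4)])
      show "(k has_derivative (\<lambda>v. c v (k y))) (at y)" if "y \<in> V" for y
        using *(7)[OF that] g'[OF that] by simp
      show "Ck_on n V (\<lambda>y. c v (k y))" for v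
        using kV *(2) by (intro Ck_on_comp[OF *(4) S1(1) _ smooth_onD[OF sc] Suc]) auto
    qed
  qed
  then have "smooth_on V k" by (simp add: smooth_on_def)
  then show thesis
    using * S1 kV by (intro that[of S V k]) (auto simp: homeomorphism_def h_def)
qed

section \<open>Fokker-Planck residuals\<close>

text \<open>Allowing \<open>f\<close> to be any expression that agrees near \<open>p\<close> with a
  differentiable \<open>g\<close> lets nested partial derivatives be rewritten from the inside
  outwards.\<close>

lemma pd_t_eq:
  assumes "open S" "p \<in> S" "\<And>q. q \<in> S \<Longrightarrow> f q = g q" "g differentiable at p"
  shows "pd_t f p = Dt g p"
proof -
  obtain t x where p: "p = (t, x)" by (cases p)
  have "f differentiable at p"
    using differentiable_cong_open[of S p g f] assms by simp
  then have "((\<lambda>s. f ((0, x) + s *\<^sub>R (1, 0))) has_real_derivative Dt f p) (at t)"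
    using has_real_derivative_line[of f "(0, x)" t "(1, 0)"] by (simp add: p)
  then show ?thesis
    using dird_cong[OF assms(1,2,3)] by (simp add: pd_t_def p DERIV_imp_deriv)
qed

lemma pd_x_eq:
  assumes "open S" "p \<in> S" "\<And>q. q \<in> S \<Longrightarrow> f q = g q" "g differentiable at p"
  shows "pd_x f p = Dx g p"
proof -
  obtain t x where p: "p = (t, x)" by (cases p)
  have "f differentiable at p"
    using differentiable_cong_open[of S p g f] assms by simp
  then have "((\<lambda>s. f ((t, 0) + s *\<^sub>R (0, 1))) has_real_derivative Dx f p) (at x)"
    using has_real_derivative_line[of f "(t, 0)" x "(0, 1)"] by (simp add: p)
  then show ?thesis
    using dird_cong[OF assms(1,2,3)] by (simp add: pd_x_def p DERIV_imp_deriv)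
qed

lemma pd_smooth:
  assumes "open S" "smooth_on S f" "p \<in> S"
  shows "pd_t f p = Dt f p" "pd_x f p = Dx f p" "pd_x (pd_x f) p = Dx (Dx f) p"
proof -
  have *: "pd_t f q = Dt f q" "pd_x f q = Dx f q" if "q \<in> S" for q
    using pd_t_eq[OF assms(1) that refl] pd_x_eq[OF assms(1) that refl]
      smooth_on_differentiable[OF assms(2) that] by blast+
  show "pd_t f p = Dt f p" "pd_x f p = Dx f p"
    by (rule *[OF assms(3)])+
  show "pd_x (pd_x f) p = Dx (Dx f) p"
    by (rule pd_x_eq[OF assms(1,3) *(2) smooth_on_differentiable[OF smooth_on_dird[OF assms(2)] assms(3)]])
qed

section \<open>Second-order product and chain rules\<close>

lemma dird_mult_smooth:
  fixes f g :: "'a::real_normed_vector \<Rightarrow> real"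
  assumes "smooth_on S f" "smooth_on S g" "p \<in> S"
  shows "dird v (\<lambda>q. f q * g q) p = f p * dird v g p + dird v f p * g p"
  using assms by (intro dird_mult smooth_on_differentiable)

lemma dird_dird_mult:
  fixes f g :: "'a::real_normed_vector \<Rightarrow> real"
  assumes S: "open S" "smooth_on S f" "smooth_on S g" "p \<in> S"
  shows "dird w (dird v (\<lambda>q. f q * g q)) p =
    f p * dird w (dird v g) p + dird w f p * dird v g p + dird v f p * dird w g p + dird w (dird v f) p * g p"
proof -
  have "dird w (dird v (\<lambda>q. f q * g q)) p = dird w (\<lambda>q. f q * dird v g q + dird v f q * g q) p"
    by (rule dird_cong[OF S(1,4)]) (rule dird_mult_smooth[OF S(2,3)])
  moreover have "dird w (\<lambda>q. f q * dird v g q + dird v f q * g q) p =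
      dird w (\<lambda>q. f q * dird v g q) p + dird w (\<lambda>q. dird v f q * g q) p"
    by (intro dird_add smooth_on_differentiable[of S] smooth_on_mult smooth_on_dird S)
  moreover have "dird w (\<lambda>q. f q * dird v g q) p = f p * dird w (dird v g) p + dird w f p * dird v g p"
    by (rule dird_mult_smooth[OF S(2) smooth_on_dird[OF S(3)] S(4)])
  moreover have "dird w (\<lambda>q. dird v f q * g q) p = dird v f p * dird w g p + dird w (dird v f) p * g p"
    by (rule dird_mult_smooth[OF smooth_on_dird[OF S(2)] S(3,4)])
  ultimately show ?thesis by (simp only: add_ac)
qed

lemma dird_dird_add:
  assumes S: "open S" "smooth_on S f" "smooth_on S g" "p \<in> S"
  shows "dird w (dird v (\<lambda>q. f q + g q)) p = dird w (dird v f) p + dird w (dird v g) p"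
proof -
  have "dird w (dird v (\<lambda>q. f q + g q)) p = dird w (\<lambda>q. dird v f q + dird v g q) p"
    by (rule dird_cong[OF S(1,4)]) (intro dird_add smooth_on_differentiable[of S] S(2,3))
  also have "\<dots> = dird w (dird v f) p + dird w (dird v g) p"
    by (intro dird_add smooth_on_differentiable[of S] smooth_on_dird S)
  finally show ?thesis .
qed

lemma dird_comp_plane:
  fixes g :: "real \<times> real \<Rightarrow> real"
  assumes "\<tau> differentiable at p" "\<xi> differentiable at p" "g differentiable at (\<tau> p, \<xi> p)"
  shows "dird v (\<lambda>q. g (\<tau> q, \<xi> q)) p = dird v \<tau> p * Dt g (\<tau> p, \<xi> p) + dird v \<xi> p * Dx g (\<tau> p, \<xi> p)"
proof -
  have "(\<lambda>q. (\<tau> q, \<xi> q)) differentiable at p"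
    by (rule Derivative.differentiableI[OF has_derivative_Pair[OF has_derivative_dird[OF assms(1)]
        has_derivative_dird[OF assms(2)]]])
  then have "dird v (\<lambda>q. g (\<tau> q, \<xi> q)) p = dird (dird v (\<lambda>q. (\<tau> q, \<xi> q)) p) g (\<tau> p, \<xi> p)"
    by (rule dird_comp) (rule assms(3))
  also have "dird v (\<lambda>q. (\<tau> q, \<xi> q)) p = (dird v \<tau> p, dird v \<xi> p)"
    by (rule dird_Pair[OF assms(1,2)])
  finally show ?thesis using dird_plane[OF assms(3), of "dird v \<tau> p" "dird v \<xi> p"] by simp
qed

lemma dird_dird_comp_plane:
  fixes g :: "real \<times> real \<Rightarrow> real"
  assumes S: "open S" "smooth_on S \<tau>" "smooth_on S \<xi>" "p \<in> S"
    and S': "open S'" "smooth_on S' g" "\<And>q. q \<in> S \<Longrightarrow> (\<tau> q, \<xi> q) \<in> S'"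
  shows "dird w (dird v (\<lambda>q. g (\<tau> q, \<xi> q))) p =
    dird w (dird v \<tau>) p * Dt g (\<tau> p, \<xi> p) + dird w (dird v \<xi>) p * Dx g (\<tau> p, \<xi> p)
    + dird v \<tau> p * (dird w \<tau> p * Dt (Dt g) (\<tau> p, \<xi> p) + dird w \<xi> p * Dx (Dt g) (\<tau> p, \<xi> p))
    + dird v \<xi> p * (dird w \<tau> p * Dt (Dx g) (\<tau> p, \<xi> p) + dird w \<xi> p * Dx (Dx g) (\<tau> p, \<xi> p))"
proof -
  note d = smooth_on_differentiable[OF S(2)] smooth_on_differentiable[OF S(3)]
  have c: "smooth_on S (\<lambda>q. dird v g (\<tau> q, \<xi> q))" for v
    by (rule smooth_on_comp[OF S(1) S'(1) _ smooth_on_dird[OF S'(2)] smooth_on_Pair[OF S(1-3)]]) (use S'(3) in auto)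
  have 1: "dird u (\<lambda>q. h (\<tau> q, \<xi> q)) q = dird u \<tau> q * Dt h (\<tau> q, \<xi> q) + dird u \<xi> q * Dx h (\<tau> q, \<xi> q)"
    if "q \<in> S" "smooth_on S' h" for u h q
    by (rule dird_comp_plane[OF d[OF that(1)] smooth_on_differentiable[OF that(2) S'(3)[OF that(1)]]])
  have 2: "dird w (\<lambda>q. dird v \<zeta> q * h (\<tau> q, \<xi> q)) p = dird v \<zeta> p * dird w (\<lambda>q. h (\<tau> q, \<xi> q)) p
      + dird w (dird v \<zeta>) p * h (\<tau> p, \<xi> p)"
    if "smooth_on S \<zeta>" "smooth_on S (\<lambda>q. h (\<tau> q, \<xi> q))" for \<zeta> and h :: "real \<times> real \<Rightarrow> real"
    by (rule dird_mult_smooth[OF smooth_on_dird[OF that(1)] that(2) S(4)])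
  have "dird w (dird v (\<lambda>q. g (\<tau> q, \<xi> q))) p =
      dird w (\<lambda>q. dird v \<tau> q * Dt g (\<tau> q, \<xi> q) + dird v \<xi> q * Dx g (\<tau> q, \<xi> q)) p"
    by (rule dird_cong[OF S(1,4)]) (rule 1[OF _ S'(2)])
  moreover have "dird w (\<lambda>q. dird v \<tau> q * Dt g (\<tau> q, \<xi> q) + dird v \<xi> q * Dx g (\<tau> q, \<xi> q)) p
      = dird w (\<lambda>q. dird v \<tau> q * Dt g (\<tau> q, \<xi> q)) p + dird w (\<lambda>q. dird v \<xi> q * Dx g (\<tau> q, \<xi> q)) p"
    by (intro dird_add smooth_on_differentiable[of S] smooth_on_mult smooth_on_dird c S)
  ultimately show ?thesis
    unfolding 2[OF S(2) c] 2[OF S(3) c] 1[OF S(4) smooth_on_dird[OF S'(2)]]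
    by linarith
qed

text \<open>The equation expanded by the product rule, with all terms on one side. As a number
  rather than a truth value it can be scaled and added, which the transformation identities
  require.\<close>

definition fp_residual ::
  "(real \<times> real \<Rightarrow> real) \<Rightarrow> (real \<times> real \<Rightarrow> real) \<Rightarrow> (real \<times> real \<Rightarrow> real) \<Rightarrow> real \<times> real \<Rightarrow> real" where
  "fp_residual A B u p = Dt u p -
     (A p * Dx (Dx u) p + (2 * Dx A p + B p) * Dx u p + (Dx (Dx A) p + Dx B p) * u p)"

lemma fokker_planck_at_iff_residual:
  assumes S: "open S" "smooth_on S A" "smooth_on S B" "smooth_on S u" "p \<in> S"
  shows "fokker_planck_at A B u p \<longleftrightarrow> fp_residual A B u p = 0"
proof -
  have "pd_t u p = Dt u p"
    by (rule pd_smooth[OF S(1,4,5)])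
  moreover have "pd_x (\<lambda>q. B q * u q) p = Dx (\<lambda>q. B q * u q) p"
    using S by (intro pd_smooth[of S] smooth_intros)
  moreover have "pd_x (pd_x (\<lambda>q. A q * u q)) p = Dx (Dx (\<lambda>q. A q * u q)) p"
    using S by (intro pd_smooth[of S] smooth_intros)
  ultimately show ?thesis
    unfolding fokker_planck_at_def fp_residual_def
      dird_dird_mult[OF S(1,2,4,5)] dird_mult_smooth[OF S(3,4,5)]
    by (simp add: algebra_simps)
qed

lemma fp_residual_cong:
  assumes "open S" "p \<in> S" "\<And>q. q \<in> S \<Longrightarrow> u q = v q"
  shows "fp_residual A B u p = fp_residual A B v p"
proof -
  have "Dx (Dx u) p = Dx (Dx v) p"
    by (rule dird_cong[OF assms(1,2)]) (rule dird_cong[OF assms(1) _ assms(3)])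
  then show ?thesis
    using dird_cong[OF assms(1,2,3)] assms(2,3) by (simp add: fp_residual_def)
qed

lemma fp_residual_add:
  assumes S: "open S" "smooth_on S u" "smooth_on S v" "p \<in> S"
  shows "fp_residual A B (\<lambda>q. u q + v q) p = fp_residual A B u p + fp_residual A B v p"
proof -
  have "dird w (\<lambda>q. u q + v q) p = dird w u p + dird w v p" for w
    using S by (intro dird_add smooth_on_differentiable)
  then show ?thesis
    by (simp add: fp_residual_def dird_dird_add[OF S] algebra_simps)
qed

text \<open>Multiplication by \<open>\<psi>\<close> keeps the leading coefficient \<open>A\<close>
  while the drift may change from \<open>B\<close> to \<open>b\<close>; the two brackets are the
  first-order and zero-order discrepancies.\<close>

lemma fp_residual_mult:
  assumes S: "open S" "smooth_on S \<psi>" "smooth_on S f" "p \<in> S"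
  shows "fp_residual A b (\<lambda>q. \<psi> q * f q) p = \<psi> p * fp_residual A B f p
    + Dx f p * (\<psi> p * B p - 2 * Dx \<psi> p * A p - b p * \<psi> p)
    + f p * (Dt \<psi> p + \<psi> p * Dx B p - 2 * Dx \<psi> p * Dx A p - Dx (Dx \<psi>) p * A p
        - (Dx b p * \<psi> p + b p * Dx \<psi> p))"
  unfolding fp_residual_def dird_dird_mult[OF S] dird_mult_smooth[OF S(2-4)]
  by (simp add: algebra_simps)

text \<open>The equation is a conservation law, so \<open>Dx X q * g (\<tau> q, X q)\<close>, the
  density of \<open>g\<close> in the old variable, obeys one as well. The drift \<open>b\<close>
  collects the pulled-back \<open>B'\<close>, the motion \<open>Dt X\<close> of the new variable and
  a multiple of \<open>A\<close> produced by the second derivative.\<close>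

lemma fp_residual_transform:
  fixes \<tau> X A b :: "real \<times> real \<Rightarrow> real"
  assumes S: "open S" "smooth_on S \<tau>" "smooth_on S X" "smooth_on S A" "smooth_on S b" "p \<in> S"
    and S': "open S'" "smooth_on S' A'" "smooth_on S' B'" "smooth_on S' g"
      "\<And>q. q \<in> S \<Longrightarrow> (\<tau> q, X q) \<in> S'"
    and \<tau>: "\<And>q. q \<in> S \<Longrightarrow> Dx \<tau> q = 0" and X: "Dx X p \<noteq> 0"
    and A': "\<And>q. q \<in> S \<Longrightarrow> Dt \<tau> q * A' (\<tau> q, X q) = (Dx X q)\<^sup>2 * A q"
    and b: "\<And>q. q \<in> S \<Longrightarrow> b q * Dx X q = Dx (Dx X) q * A q + Dt \<tau> q * B' (\<tau> q, X q) + Dt X q"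
  shows "Dt \<tau> p * Dx X p * fp_residual A' B' g (\<tau> p, X p)
    = fp_residual A b (\<lambda>q. Dx X q * g (\<tau> q, X q)) p"
proof -
  have c: "smooth_on S (\<lambda>q. h (\<tau> q, X q))" if "smooth_on S' h" for h :: "real \<times> real \<Rightarrow> real"
    by (rule smooth_on_comp[OF S(1) S'(1) _ that smooth_on_Pair[OF S(1-3)]]) (use S'(5) in auto)
  note sX = smooth_on_dird[OF S(3)] and sT = smooth_on_dird[OF S(2)]
  have \<tau>2: "dird v (Dx \<tau>) q = 0" if "q \<in> S" for v q
    using dird_cong[where v = v, OF S(1) that \<tau>] by (simp add: dird_const)
  have Tx: "Dx (Dt \<tau>) q = 0" if "q \<in> S" for q
    using dird_commute[OF S(1,2) that] \<tau>2[OF that] by simp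
  have Txx: "Dx (Dx (Dt \<tau>)) p = 0"
    using dird_cong[where v = "(0, 1)", OF S(1,6) Tx] by (simp add: dird_const)
  have 1: "dird v (\<lambda>q. h (\<tau> q, X q)) p = dird v \<tau> p * Dt h (\<tau> p, X p) + dird v X p * Dx h (\<tau> p, X p)"
    if "smooth_on S' h" for v h
    by (rule dird_comp_plane[OF smooth_on_differentiable[OF S(2,6)] smooth_on_differentiable[OF S(3,6)]
        smooth_on_differentiable[OF that S'(5)[OF S(6)]]])
  have 2: "Dx (Dx (\<lambda>q. h (\<tau> q, X q))) p = Dx (Dx X) p * Dx h (\<tau> p, X p) + (Dx X p)\<^sup>2 * Dx (Dx h) (\<tau> p, X p)"
    if "smooth_on S' h" for h
    using dird_dird_comp_plane[OF S(1,2,3,6) S'(1) that S'(5), of "(0,1)" "(0,1)"] \<tau>[OF S(6)] \<tau>2[OF S(6)]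
    by (simp add: power2_eq_square)
  have Xt: "Dt (Dx X) p = Dx (Dt X) p"
    by (rule dird_commute[OF S(1,3,6)])
  have sq: "smooth_on S (\<lambda>q. (Dx X q)\<^sup>2)"
    by (intro smooth_intros S)
  have sqx: "Dx (\<lambda>q. (Dx X q)\<^sup>2) p = 2 * Dx X p * Dx (Dx X) p"
    unfolding power2_eq_square dird_mult_smooth[OF sX sX S(6)] by simp
  have sqxx: "Dx (Dx (\<lambda>q. (Dx X q)\<^sup>2)) p = 2 * Dx X p * Dx (Dx (Dx X)) p + 2 * (Dx (Dx X) p)\<^sup>2"
    unfolding power2_eq_square dird_dird_mult[OF S(1) sX sX S(6)] by simp
  note cg = c[OF S'(4)] and cA = c[OF S'(2)] and cB = c[OF S'(3)]
  have A0: "Dt \<tau> p * A' (\<tau> p, X p) = (Dx X p)\<^sup>2 * A p"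
    by (rule A'[OF S(6)])
  \<comment> \<open>Differentiating the relation for \<open>A'\<close> once and twice in x expresses
    the derivatives of \<open>A'\<close> at the image point through those of \<open>A\<close> and
    \<open>X\<close>.\<close>
  have "Dx (\<lambda>q. Dt \<tau> q * A' (\<tau> q, X q)) p = Dx (\<lambda>q. (Dx X q)\<^sup>2 * A q) p"
    by (rule dird_cong[OF S(1,6) A'])
  then have A1: "Dt \<tau> p * (Dx X p * Dx A' (\<tau> p, X p)) = (Dx X p)\<^sup>2 * Dx A p + 2 * Dx X p * Dx (Dx X) p * A p"
    unfolding dird_mult_smooth[OF sT cA S(6)] dird_mult_smooth[OF sq S(4,6)] 1[OF S'(2)] sqx
    by (simp add: Tx[OF S(6)] \<tau>[OF S(6)])
  have "Dx (Dx (\<lambda>q. Dt \<tau> q * A' (\<tau> q, X q))) p = Dx (Dx (\<lambda>q. (Dx X q)\<^sup>2 * A q)) p"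
    by (rule dird_cong[OF S(1,6)]) (rule dird_cong[OF S(1) _ A'])
  then have A2: "Dt \<tau> p * (Dx (Dx X) p * Dx A' (\<tau> p, X p) + (Dx X p)\<^sup>2 * Dx (Dx A') (\<tau> p, X p))
    = (Dx X p)\<^sup>2 * Dx (Dx A) p + 4 * Dx X p * Dx (Dx X) p * Dx A p
      + (2 * Dx X p * Dx (Dx (Dx X)) p + 2 * (Dx (Dx X) p)\<^sup>2) * A p"
    unfolding dird_dird_mult[OF S(1) sT cA S(6)] dird_dird_mult[OF S(1) sq S(4,6)] 2[OF S'(2)] 1[OF S'(2)] sqx sqxx
    by (simp add: Tx[OF S(6)] Txx \<tau>[OF S(6)])
  have b0: "b p * Dx X p = Dx (Dx X) p * A p + Dt \<tau> p * B' (\<tau> p, X p) + Dt X p"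
    by (rule b[OF S(6)])
  \<comment> \<open>The same for \<open>B'\<close>, from the relation that determines
    \<open>b\<close>.\<close>
  have "Dx (\<lambda>q. b q * Dx X q) p = Dx (\<lambda>q. Dx (Dx X) q * A q + Dt \<tau> q * B' (\<tau> q, X q) + Dt X q) p"
    by (rule dird_cong[OF S(1,6) b])
  moreover have "Dx (\<lambda>q. Dx (Dx X) q * A q + Dt \<tau> q * B' (\<tau> q, X q) + Dt X q) p
      = Dx (\<lambda>q. Dx (Dx X) q * A q + Dt \<tau> q * B' (\<tau> q, X q)) p + Dx (Dt X) p"
    by (intro dird_add smooth_on_differentiable[of S] smooth_on_add smooth_on_mult smooth_on_dird S cB)
  moreover have "Dx (\<lambda>q. Dx (Dx X) q * A q + Dt \<tau> q * B' (\<tau> q, X q)) p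
      = Dx (\<lambda>q. Dx (Dx X) q * A q) p + Dx (\<lambda>q. Dt \<tau> q * B' (\<tau> q, X q)) p"
    by (intro dird_add smooth_on_differentiable[of S] smooth_on_mult smooth_on_dird S cB)
  ultimately have b1: "b p * Dx (Dx X) p + Dx b p * Dx X p =
      Dx (Dx X) p * Dx A p + Dx (Dx (Dx X)) p * A p + Dt \<tau> p * (Dx X p * Dx B' (\<tau> p, X p)) + Dx (Dt X) p"
    unfolding dird_mult_smooth[OF S(5) sX S(6)] dird_mult_smooth[OF smooth_on_dird[OF sX] S(4,6)]
      dird_mult_smooth[OF sT cB S(6)] 1[OF S'(3)]
    by (simp add: Tx[OF S(6)] \<tau>[OF S(6)])
  \<comment> \<open>One factor \<open>Dx X p\<close> is cancelled here and in \<open>A2'\<close>, so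
    that the final identity is polynomial.\<close>
  have A1': "Dt \<tau> p * Dx A' (\<tau> p, X p) = Dx X p * Dx A p + 2 * Dx (Dx X) p * A p"
  proof -
    have "Dx X p * (Dt \<tau> p * Dx A' (\<tau> p, X p)) = Dx X p * (Dx X p * Dx A p + 2 * Dx (Dx X) p * A p)"
      using A1 by (simp add: algebra_simps power2_eq_square)
    then show ?thesis using X by simp
  qed
  have A2': "Dx X p * (Dt \<tau> p * Dx (Dx A') (\<tau> p, X p)) =
      Dx X p * Dx (Dx A) p + 3 * Dx (Dx X) p * Dx A p + 2 * Dx (Dx (Dx X)) p * A p"
  proof -
    have "Dx X p * (Dx X p * (Dt \<tau> p * Dx (Dx A') (\<tau> p, X p))) =
        Dt \<tau> p * (Dx (Dx X) p * Dx A' (\<tau> p, X p) + (Dx X p)\<^sup>2 * Dx (Dx A') (\<tau> p, X p))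
        - Dx (Dx X) p * (Dt \<tau> p * Dx A' (\<tau> p, X p))"
      by (simp add: algebra_simps power2_eq_square)
    also have "\<dots> = Dx X p * (Dx X p * Dx (Dx A) p + 3 * Dx (Dx X) p * Dx A p + 2 * Dx (Dx (Dx X)) p * A p)"
      unfolding A2 A1' by (simp add: algebra_simps power2_eq_square)
    finally show ?thesis using X by simp
  qed
  have b0': "Dt \<tau> p * B' (\<tau> p, X p) = b p * Dx X p - Dx (Dx X) p * A p - Dt X p"
    using b0 by simp
  have b1': "Dt \<tau> p * (Dx X p * Dx B' (\<tau> p, X p)) = b p * Dx (Dx X) p + Dx b p * Dx X p
      - Dx (Dx X) p * Dx A p - Dx (Dx (Dx X)) p * A p - Dx (Dt X) p"
    using b1 by simp
  \<comment> \<open>Each target coefficient is grouped with the factors with which the relations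
    above replace it.\<close>
  have "Dt \<tau> p * Dx X p * fp_residual A' B' g (\<tau> p, X p) =
      Dt \<tau> p * Dx X p * Dt g (\<tau> p, X p)
      - Dx X p * (Dt \<tau> p * A' (\<tau> p, X p)) * Dx (Dx g) (\<tau> p, X p)
      - (2 * Dx X p * (Dt \<tau> p * Dx A' (\<tau> p, X p)) + Dx X p * (Dt \<tau> p * B' (\<tau> p, X p))) * Dx g (\<tau> p, X p)
      - (Dx X p * (Dt \<tau> p * Dx (Dx A') (\<tau> p, X p)) + Dt \<tau> p * (Dx X p * Dx B' (\<tau> p, X p))) * g (\<tau> p, X p)"
    unfolding fp_residual_def by (simp add: algebra_simps)
  also have "\<dots> = fp_residual A b (\<lambda>q. Dx X q * g (\<tau> q, X q)) p"
    unfolding A0 A1' A2' b0' b1' fp_residual_def dird_dird_mult[OF S(1) sX cg S(6)] dird_mult_smooth[OF sX cg S(6)]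
      1[OF S'(4)] 2[OF S'(4)] Xt \<tau>[OF S(6)]
    by (simp add: algebra_simps power2_eq_square)
  finally show ?thesis .
qed

section \<open>Graphs and jets\<close>

type_synonym space = "real \<times> real \<times> real"

abbreviation St :: "(space \<Rightarrow> real) \<Rightarrow> space \<Rightarrow> real" where "St \<equiv> dird (1, 0, 0)"
abbreviation Sx :: "(space \<Rightarrow> real) \<Rightarrow> space \<Rightarrow> real" where "Sx \<equiv> dird (0, 1, 0)"
abbreviation Su :: "(space \<Rightarrow> real) \<Rightarrow> space \<Rightarrow> real" where "Su \<equiv> dird (0, 0, 1)"

lemma dird_space:
  fixes F :: "space \<Rightarrow> real"
  assumes "F differentiable at p"
  shows "dird (a, b, c) F p = a * St F p + b * Sx F p + c * Su F p"
proof -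
  have "dird (a *\<^sub>R (1, 0, 0) + b *\<^sub>R (0, 1, 0) + c *\<^sub>R (0, 0, 1)) F p = a * St F p + b * Sx F p + c * Su F p"
    by (simp only: linear_add[OF linear_dird[OF assms]] linear_scale[OF linear_dird[OF assms]]) simp
  then show ?thesis by simp
qed

lemma dird_graph:
  fixes f :: "real \<times> real \<Rightarrow> real" and F :: "space \<Rightarrow> real"
  assumes "f differentiable at q" "F differentiable at (fst q, snd q, f q)"
  shows "dird v (\<lambda>q. F (fst q, snd q, f q)) q = dird (fst v, snd v, dird v f q) F (fst q, snd q, f q)"
proof -
  have "((\<lambda>q. (fst q, snd q, f q)) has_derivative (\<lambda>v. (fst v, snd v, dird v f q))) (at q)"
    using has_derivative_dird[OF assms(1)] by (auto intro!: derivative_eq_intros)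
  from diff_chain_at[OF this has_derivative_dird[OF assms(2)]] show ?thesis
    by (intro dird_eqI[where f' = "\<lambda>v. dird (fst v, snd v, dird v f q) F (fst q, snd q, f q)"])
      (simp only: o_def)
qed

lemma smooth_on_graph:
  fixes f :: "real \<times> real \<Rightarrow> real" and F :: "space \<Rightarrow> 'a::real_normed_vector"
  assumes "open S" "smooth_on S f" "open W" "smooth_on W F" "\<And>q. q \<in> S \<Longrightarrow> (fst q, snd q, f q) \<in> W"
  shows "smooth_on S (\<lambda>q. F (fst q, snd q, f q))"
proof (rule smooth_on_comp[OF assms(1,3) _ assms(4)])
  show "smooth_on S (\<lambda>q. (fst q, snd q, f q))"
    using assms(1,2) by (intro smooth_on_Pair smooth_on_fst smooth_on_snd smooth_on_ident)
qed (use assms(5) in auto)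

text \<open>The first term differentiates \<open>F\<close> twice with the inner direction frozen at
  \<open>q\<close>; the second comes from the change of that direction along the graph, which
  affects only its u-component.\<close>

lemma dird_dird_graph:
  fixes f :: "real \<times> real \<Rightarrow> real" and F :: "space \<Rightarrow> real"
  assumes S: "open S" "smooth_on S f" "open W" "smooth_on W F"
    and W: "\<And>q. q \<in> S \<Longrightarrow> (fst q, snd q, f q) \<in> W" and q: "q \<in> S"
  shows "dird w (dird v (\<lambda>q. F (fst q, snd q, f q))) q =
    dird (fst w, snd w, dird w f q) (dird (fst v, snd v, dird v f q) F) (fst q, snd q, f q)
    + dird w (dird v f) q * Su F (fst q, snd q, f q)"
proof -
  define p where "p = (fst q, snd q, f q)"
  have p: "p \<in> W" using W[OF q] by (simp add: p_def)
  have F: "F differentiable at r" if "r \<in> W" for r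
    by (rule smooth_on_differentiable[OF S(4) that])
  have dF: "dird u F differentiable at r" if "r \<in> W" for u r
    by (rule smooth_on_differentiable[OF smooth_on_dird[OF S(4)] that])
  have f: "f differentiable at r" if "r \<in> S" for r
    by (rule smooth_on_differentiable[OF S(2) that])
  \<comment> \<open>Isolates the u-component, the only part of the direction that varies along the
    graph.\<close>
  have split: "dird (a, b, c) F r = dird (a, b, 0) F r + c * Su F r" if "r \<in> W" for a b c r
    using dird_space[OF F[OF that], of a b c] dird_space[OF F[OF that], of a b 0] by simp
  have c: "smooth_on S (\<lambda>q. dird u F (fst q, snd q, f q))" for u
    by (rule smooth_on_graph[OF S(1-3) smooth_on_dird[OF S(4)] W])
  have 1: "dird w (\<lambda>q. dird u F (fst q, snd q, f q)) q = dird (fst w, snd w, dird w f q) (dird u F) p" for u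
    unfolding p_def by (rule dird_graph[OF f[OF q] dF[OF W[OF q]]])
  have "dird w (dird v (\<lambda>q. F (fst q, snd q, f q))) q =
      dird w (\<lambda>q. dird (fst v, snd v, 0) F (fst q, snd q, f q) + dird v f q * Su F (fst q, snd q, f q)) q"
    by (rule dird_cong[OF S(1) q], rule trans[OF dird_graph[OF f F[OF W]] split[OF W]])
  moreover have "dird w (\<lambda>q. dird (fst v, snd v, 0) F (fst q, snd q, f q) + dird v f q * Su F (fst q, snd q, f q)) q
    = dird w (\<lambda>q. dird (fst v, snd v, 0) F (fst q, snd q, f q)) q
      + dird w (\<lambda>q. dird v f q * Su F (fst q, snd q, f q)) q"
    by (intro dird_add smooth_on_differentiable[of S] smooth_on_mult smooth_on_dird c S q)
  moreover have "dird w (\<lambda>q. dird v f q * Su F (fst q, snd q, f q)) q =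
      dird v f q * dird (fst w, snd w, dird w f q) (Su F) p + dird w (dird v f) q * Su F p"
    unfolding p_def using dird_mult_smooth[OF smooth_on_dird[OF S(2)] c q, of w v] 1[unfolded p_def]
    by simp
  moreover have "dird (fst w, snd w, dird w f q) (dird (fst v, snd v, dird v f q) F) p =
      dird (fst w, snd w, dird w f q) (dird (fst v, snd v, 0) F) p
      + dird v f q * dird (fst w, snd w, dird w f q) (Su F) p"
    (is "dird ?z _ _ = _")
  proof -
    have "dird ?z (dird (fst v, snd v, dird v f q) F) p =
        dird ?z (\<lambda>r. dird (fst v, snd v, 0) F r + dird v f q * Su F r) p"
      by (rule dird_cong[OF S(3) p split])
    moreover have "dird ?z (\<lambda>r. dird (fst v, snd v, 0) F r + dird v f q * Su F r) p =
        dird ?z (dird (fst v, snd v, 0) F) p + dird ?z (\<lambda>r. dird v f q * Su F r) p"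
      by (intro dird_add smooth_on_differentiable[of W] smooth_on_mult smooth_on_const smooth_on_dird S p)
    moreover have "dird ?z (\<lambda>r. dird v f q * Su F r) p = dird v f q * dird ?z (Su F) p"
      by (rule dird_bounded_linear[OF bounded_linear_mult_right dF[OF p]])
    ultimately show ?thesis by linarith
  qed
  ultimately show ?thesis
    unfolding 1 p_def[symmetric] by linarith
qed

text \<open>The test functions: at \<open>q0\<close> they realize any 2-jet with zero mixed
  derivative, \<open>c\<close> being the second derivative in x and \<open>d\<close> the one in
  t.\<close>

definition jet :: "real \<times> real \<Rightarrow> real \<Rightarrow> real \<Rightarrow> real \<Rightarrow> real \<Rightarrow> real \<Rightarrow> real \<times> real \<Rightarrow> real" where
  "jet q0 u0 a b c d = (\<lambda>q. u0 + a * (fst q - fst q0) + b * (snd q - snd q0)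
     + c * (snd q - snd q0)\<^sup>2 / 2 + d * (fst q - fst q0)\<^sup>2 / 2)"

lemma jet_smooth: "smooth_on UNIV (jet q0 u0 a b c d)"
  unfolding jet_def
  by (intro smooth_on_add smooth_on_mult smooth_on_divide smooth_on_power smooth_on_diff smooth_on_const
      smooth_on_fst smooth_on_snd smooth_on_ident open_UNIV) simp_all

lemma jet_dird:
  "dird v (jet q0 u0 a b c d) = (\<lambda>q. fst v * (a + d * (fst q - fst q0)) + snd v * (b + c * (snd q - snd q0)))"
proof
  fix q
  have "(jet q0 u0 a b c d has_derivative
      (\<lambda>v. fst v * (a + d * (fst q - fst q0)) + snd v * (b + c * (snd q - snd q0)))) (at q)"
    unfolding jet_def by (auto intro!: derivative_eq_intros simp: field_simps)
  then show "dird v (jet q0 u0 a b c d) q =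
      fst v * (a + d * (fst q - fst q0)) + snd v * (b + c * (snd q - snd q0))"
    by (rule dird_eqI)
qed

lemma jet_dird_dird:
  "dird w (dird v (jet q0 u0 a b c d)) q = fst v * fst w * d + snd v * snd w * c"
proof -
  have "((\<lambda>q. fst v * (a + d * (fst q - fst q0)) + snd v * (b + c * (snd q - snd q0))) has_derivative
      (\<lambda>w. fst v * fst w * d + snd v * snd w * c)) (at q)"
    by (auto intro!: derivative_eq_intros simp: algebra_simps)
  then show ?thesis unfolding jet_dird by (rule dird_eqI)
qed

lemma jet_0: "jet q0 u0 a b c d q0 = u0"
  by (simp add: jet_def)

text \<open>\<open>J\<close> concerns the Jacobian determinant of the base map \<open>(T, X)\<close>
  along the graph. Where it is nonzero the base map has a smooth local inverse \<open>k\<close>, and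
  the image is the graph of \<open>U\<close> evaluated over \<open>k y\<close>.\<close>

lemma graph_transform:
  fixes f :: "real \<times> real \<Rightarrow> real" and T X U :: "space \<Rightarrow> real"
  assumes W: "open W" "smooth_on W T" "smooth_on W X" "smooth_on W U"
    and \<Phi>: "\<And>p. p \<in> W \<Longrightarrow> \<Phi> p = (T p, X p, U p)"
    and f: "smooth_on UNIV f" and p0: "(fst q0, snd q0, f q0) \<in> W"
    and J: "Dt (\<lambda>q. T (fst q, snd q, f q)) q0 * Dx (\<lambda>q. X (fst q, snd q, f q)) q0
      - Dx (\<lambda>q. T (fst q, snd q, f q)) q0 * Dt (\<lambda>q. X (fst q, snd q, f q)) q0 \<noteq> 0"
  obtains S S' g where "open S" "open S'" "q0 \<in> S" "smooth_on S' g" "graph_over S f \<subseteq> W"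
    "\<Phi> ` graph_over S f = graph_over S' g"
proof -
  define S0 where "S0 = (\<lambda>q. (fst q, snd q, f q)) -` W"
  have "continuous_on UNIV (\<lambda>q. (fst q, snd q, f q))"
    using smooth_on_continuous[OF f] by (intro continuous_intros)
  then have S0: "open S0" "q0 \<in> S0" "\<And>q. q \<in> S0 \<Longrightarrow> (fst q, snd q, f q) \<in> W"
    using W(1) p0 by (auto simp: S0_def open_vimage)
  have f0: "smooth_on S0 f" using f smooth_on_subset by blast
  note lift = smooth_on_graph[OF S0(1) f0 W(1) _ S0(3)]
  obtain S V k where k: "open S" "open V" "q0 \<in> S" "S \<subseteq> S0"
    "(\<lambda>q. (T (fst q, snd q, f q), X (fst q, snd q, f q))) ` S = V"
    "smooth_on V k" "\<And>q. q \<in> S \<Longrightarrow> k (T (fst q, snd q, f q), X (fst q, snd q, f q)) = q"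
    "\<And>y. y \<in> V \<Longrightarrow> k y \<in> S"
    using smooth_local_inverse_plane[OF S0(1) lift[OF W(2)] lift[OF W(3)] S0(2) J] by blast
  define g where "g y = U (fst (k y), snd (k y), f (k y))" for y
  have "smooth_on V g"
    unfolding g_def using k
    by (intro smooth_on_comp[OF k(2) S0(1) _ lift[OF W(4)] k(6)]) auto
  moreover have sub: "graph_over S f \<subseteq> W"
    using k(4) S0(3) by (auto simp: graph_over_def)
  moreover have "\<Phi> ` graph_over S f = graph_over V g"
  proof -
    have "\<Phi> (fst q, snd q, f q) = (\<lambda>(t, x). (t, x, g (t, x))) (T (fst q, snd q, f q), X (fst q, snd q, f q))"
      if "q \<in> S" for q
      using \<Phi>[OF S0(3)[OF subsetD[OF k(4) that]]] k(7)[OF that] by (simp add: g_def)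
    moreover have "\<Phi> ` graph_over S f = (\<lambda>q. \<Phi> (fst q, snd q, f q)) ` S"
      by (simp add: graph_over_def image_image case_prod_unfold)
    ultimately have "\<Phi> ` graph_over S f =
        (\<lambda>q. (\<lambda>(t, x). (t, x, g (t, x))) (T (fst q, snd q, f q), X (fst q, snd q, f q))) ` S"
      by (simp cong: image_cong)
    also have "\<dots> = graph_over V g"
      unfolding graph_over_def k(5)[symmetric] image_image ..
    finally show ?thesis .
  qed
  ultimately show thesis using that k by blast
qed

lemma graph_over_image:
  assumes "\<Phi> ` graph_over S f = graph_over S' g" "q \<in> S" "\<Phi> (fst q, snd q, f q) = (t', x', u')"
  shows "(t', x') \<in> S'" "u' = g (t', x')"
proof -
  have "(fst q, snd q, f q) \<in> graph_over S f"
    using assms(2) by (auto simp: graph_over_def case_prod_unfold)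
  then have "(t', x', u') \<in> graph_over S' g"
    using assms(1,3) by (metis imageI)
  then show "(t', x') \<in> S'" "u' = g (t', x')"
    by (auto simp: graph_over_def)
qed

section \<open>Determining the form of the transformation\<close>

locale fp_transformation =
  fixes A B A' B' :: "real \<times> real \<Rightarrow> real"
    and D D' :: "(real \<times> real) set"
    and W :: "space set"
    and \<Phi> :: "space \<Rightarrow> space"
  assumes source: "fp_coefficients D A B"
    and target: "fp_coefficients D' A' B'"
    and transformation: "point_transformation W \<Phi>"
    and domain: "proj_tx W \<subseteq> D"
    and codomain: "proj_tx (\<Phi> ` W) \<subseteq> D'"
begin

section \<open>Components of the transformation and nondegenerate 1-jets\<close>

definition "T p = fst (\<Phi> p)"
definition "X p = fst (snd (\<Phi> p))"
definition "U p = snd (snd (\<Phi> p))"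

lemma \<Phi>_eq: "\<Phi> p = (T p, X p, U p)"
  by (simp add: T_def X_def U_def)

lemma open_W: "open W"
  using transformation by (simp add: point_transformation_def)

lemma smooth_\<Phi>: "smooth_on W \<Phi>"
proof (rule smooth_on_locally)
  fix p assume "p \<in> W"
  then show "\<exists>N. open N \<and> p \<in> N \<and> smooth_on N \<Phi>"
    using transformation unfolding point_transformation_def by meson
qed

lemma smooth_T: "smooth_on W T" and smooth_X: "smooth_on W X" and smooth_U: "smooth_on W U"
  unfolding T_def[abs_def] X_def[abs_def] U_def[abs_def]
  by (intro smooth_on_fst smooth_on_snd open_W smooth_\<Phi>)+

lemma coefficients:
  "open D" "smooth_on D A" "smooth_on D B" "open D'" "smooth_on D' A'" "smooth_on D' B'"
  "q \<in> D \<Longrightarrow> A q \<noteq> 0" "q' \<in> D' \<Longrightarrow> A' q' \<noteq> 0"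
  using source target by (simp_all add: fp_coefficients_def)

lemma in_D: "(t, x, u) \<in> W \<Longrightarrow> (t, x) \<in> D"
  using domain imageI[of "(t, x, u)" W "\<lambda>(t, x, u). (t, x)"] by (auto simp: proj_tx_def)

lemma in_D':
  assumes "p \<in> W"
  shows "(T p, X p) \<in> D'"
proof -
  have "(\<lambda>(t, x, u). (t, x)) (\<Phi> p) \<in> proj_tx (\<Phi> ` W)"
    unfolding proj_tx_def by (intro imageI assms)
  then show ?thesis
    using codomain by (auto simp: \<Phi>_eq[of p])
qed

lemma differentiable_TXU:
  "p \<in> W \<Longrightarrow> T differentiable at p" "p \<in> W \<Longrightarrow> X differentiable at p" "p \<in> W \<Longrightarrow> U differentiable at p"
  using smooth_T smooth_X smooth_U smooth_on_differentiable by blast+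

lemma dird_\<Phi>: "p \<in> W \<Longrightarrow> dird v \<Phi> p = (dird v T p, dird v X p, dird v U p)"
  unfolding T_def[abs_def] X_def[abs_def] U_def[abs_def]
  using smooth_on_differentiable[OF smooth_\<Phi>, of p]
    smooth_on_differentiable[OF smooth_on_snd[OF open_W smooth_\<Phi>], of p]
  by (simp add: dird_bounded_linear[OF bounded_linear_fst] dird_bounded_linear[OF bounded_linear_snd])

text \<open>A smooth local inverse makes the derivative injective, and an injective linear
  endomorphism of a finite-dimensional space is onto.\<close>

lemma surj_dird_\<Phi>:
  assumes "p \<in> W"
  shows "surj (\<lambda>v. dird v \<Phi> p)"
proof -
  obtain N \<Psi> where N: "open N" "p \<in> N" "N \<subseteq> W" "smooth_on (\<Phi> ` N) \<Psi>" "\<And>q. q \<in> N \<Longrightarrow> \<Psi> (\<Phi> q) = q"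
    using transformation assms unfolding point_transformation_def by meson
  have d: "\<Phi> differentiable at p" "\<Psi> differentiable at (\<Phi> p)"
    using smooth_on_differentiable[OF smooth_\<Phi> assms] smooth_on_differentiable[OF N(4)] N(2) by blast+
  have "dird (dird v \<Phi> p) \<Psi> (\<Phi> p) = v" for v
  proof -
    have "dird v (\<lambda>q. \<Psi> (\<Phi> q)) p = dird v (\<lambda>q. q) p"
      by (rule dird_cong[OF N(1,2,5)])
    also have "dird v (\<lambda>q. q) p = v"
      by (simp add: dird_def)
    finally show ?thesis using dird_comp[OF d] by metis
  qed
  then have "inj (\<lambda>v. dird v \<Phi> p)"
    by (rule inj_on_inverseI[of _ "\<lambda>w. dird w \<Psi> (\<Phi> p)"])
  then show ?thesis
    by (rule linear_injective_imp_surjective[OF linear_dird[OF d(1)]]) (rule refl)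
qed

text \<open>By surjectivity \<open>(\<alpha>, \<beta>, \<gamma>)\<close> is a value of the
  derivative, while the three relations make it orthogonal to all values, hence to itself.\<close>

lemma gradients_independent:
  assumes p: "p \<in> W"
    and "\<alpha> * St T p + \<beta> * St X p + \<gamma> * St U p = 0"
    and "\<alpha> * Sx T p + \<beta> * Sx X p + \<gamma> * Sx U p = 0"
    and "\<alpha> * Su T p + \<beta> * Su X p + \<gamma> * Su U p = 0"
  shows "\<alpha> = 0" "\<beta> = 0" "\<gamma> = 0"
proof -
  obtain v where v: "dird v \<Phi> p = (\<alpha>, \<beta>, \<gamma>)"
    using surjD[OF surj_dird_\<Phi>[OF p], of "(\<alpha>, \<beta>, \<gamma>)"] by auto
  obtain a b c where abc: "v = (a, b, c)" by (rule prod_cases3)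
  have e: "a * St T p + b * Sx T p + c * Su T p = \<alpha>" "a * St X p + b * Sx X p + c * Su X p = \<beta>"
    "a * St U p + b * Sx U p + c * Su U p = \<gamma>"
    using dird_\<Phi>[OF p, of v] unfolding v unfolding abc
      dird_space[OF differentiable_TXU(1)[OF p], of a b c] dird_space[OF differentiable_TXU(2)[OF p], of a b c]
      dird_space[OF differentiable_TXU(3)[OF p], of a b c]
    by simp_all
  have "\<alpha> * \<alpha> + \<beta> * \<beta> + \<gamma> * \<gamma> = \<alpha> * (a * St T p + b * Sx T p + c * Su T p)
      + \<beta> * (a * St X p + b * Sx X p + c * Su X p) + \<gamma> * (a * St U p + b * Sx U p + c * Su U p)"
    by (simp only: e)
  also have "\<dots> = a * (\<alpha> * St T p + \<beta> * St X p + \<gamma> * St U p) + b * (\<alpha> * Sx T p + \<beta> * Sx X p + \<gamma> * Sx U p)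
      + c * (\<alpha> * Su T p + \<beta> * Su X p + \<gamma> * Su U p)"
    by (simp add: algebra_simps)
  finally have "\<alpha> * \<alpha> + \<beta> * \<beta> + \<gamma> * \<gamma> = 0" by (simp only: assms mult_zero_right add_0)
  then have "\<alpha> * \<alpha> = 0" "\<beta> * \<beta> = 0" "\<gamma> * \<gamma> = 0"
    using zero_le_square[of \<alpha>] zero_le_square[of \<beta>] zero_le_square[of \<gamma>] by linarith+
  then show "\<alpha> = 0" "\<beta> = 0" "\<gamma> = 0"
    by simp_all
qed

text \<open>The Jacobian determinant of \<open>(T, X)\<close> along a graph through \<open>p\<close>
  with slopes \<open>a\<close> in t and \<open>b\<close> in x. The terms with the product of
  \<open>a\<close> and \<open>b\<close> cancel, so it is affine in the slopes.\<close>

definition jacobian :: "space \<Rightarrow> real \<Rightarrow> real \<Rightarrow> real" where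
  "jacobian p a b = (St T p + a * Su T p) * (Sx X p + b * Su X p) - (Sx T p + b * Su T p) * (St X p + a * Su X p)"

lemma jacobian_eq:
  assumes "p \<in> W"
  shows "jacobian p a b = dird (1, 0, a) T p * dird (0, 1, b) X p - dird (0, 1, b) T p * dird (1, 0, a) X p"
  using dird_space[OF differentiable_TXU(1)[OF assms], of 1 0 a] dird_space[OF differentiable_TXU(1)[OF assms], of 0 1 b]
    dird_space[OF differentiable_TXU(2)[OF assms], of 1 0 a] dird_space[OF differentiable_TXU(2)[OF assms], of 0 1 b]
  by (simp add: jacobian_def)

text \<open>Vanishing at the slopes (0, 0), (1, 0) and (0, 1) would annihilate all 2 by 2 minors of
  the gradients of \<open>T\<close> and \<open>X\<close>, against their independence.\<close>

lemma jacobian_nonzero: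
  assumes p: "p \<in> W"
  obtains a b where "jacobian p a b \<noteq> 0"
proof -
  have "\<not> (jacobian p 0 0 = 0 \<and> jacobian p 1 0 = 0 \<and> jacobian p 0 1 = 0)"
  proof
    assume j: "jacobian p 0 0 = 0 \<and> jacobian p 1 0 = 0 \<and> jacobian p 0 1 = 0"
    have m: "St T p * Sx X p = Sx T p * St X p" "Su T p * Sx X p = Sx T p * Su X p"
        "St T p * Su X p = Su T p * St X p"
      using j by (auto simp: jacobian_def algebra_simps)
    \<comment> \<open>Each component of the gradient of \<open>T\<close> occurs as a coefficient in
      a vanishing combination of the two gradients, so it is zero.\<close>
    have "St T p = 0"
      using gradients_independent(2)[OF p, of "St X p" "- St T p" 0] m by (simp add: algebra_simps)
    moreover have "Sx T p = 0"
      using gradients_independent(2)[OF p, of "Sx X p" "- Sx T p" 0] m by (simp add: algebra_simps)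
    moreover have "Su T p = 0"
      using gradients_independent(2)[OF p, of "Su X p" "- Su T p" 0] m by (simp add: algebra_simps)
    ultimately show False
      using gradients_independent(1)[OF p, of 1 0 0] by simp
  qed
  then show thesis using that by blast
qed

text \<open>\<open>g1\<close>, \<open>g2\<close> and \<open>hij\<close> stand for the first and second derivatives at the image point of a
  function \<open>g\<close> whose graph is the image of the graph of a function with the jet
  \<open>u\<^sub>t = a\<close>, \<open>u\<^sub>x = b\<close>, \<open>u\<^sub>x\<^sub>x = c\<close>, \<open>u\<^sub>t\<^sub>t = d\<close>, \<open>u\<^sub>t\<^sub>x = 0\<close>; the relations are the chain rule for
  \<open>g (T, X) = U\<close> and the target equation for \<open>g\<close>.\<close>

definition jet_relations ::
  "space \<Rightarrow> real \<Rightarrow> real \<Rightarrow> real \<Rightarrow> real \<Rightarrow> real \<Rightarrow> real \<Rightarrow> real \<Rightarrow> real \<Rightarrow> real \<Rightarrow> real \<Rightarrow> bool" where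
  "jet_relations p a b c d g1 g2 h11 h12 h21 h22 \<longleftrightarrow>
    (\<forall>v1 v2.
       dird (v1, v2, v1 * a + v2 * b) U p =
       dird (v1, v2, v1 * a + v2 * b) T p * g1 + dird (v1, v2, v1 * a + v2 * b) X p * g2) \<and>
    (\<forall>v1 v2 w1 w2.
       dird (w1, w2, w1 * a + w2 * b) (dird (v1, v2, v1 * a + v2 * b) U) p + (v1 * w1 * d + v2 * w2 * c) * Su U p =
       (dird (w1, w2, w1 * a + w2 * b) (dird (v1, v2, v1 * a + v2 * b) T) p + (v1 * w1 * d + v2 * w2 * c) * Su T p) * g1
       + (dird (w1, w2, w1 * a + w2 * b) (dird (v1, v2, v1 * a + v2 * b) X) p + (v1 * w1 * d + v2 * w2 * c) * Su X p) * g2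
       + dird (v1, v2, v1 * a + v2 * b) T p *
          (dird (w1, w2, w1 * a + w2 * b) T p * h11 + dird (w1, w2, w1 * a + w2 * b) X p * h12)
       + dird (v1, v2, v1 * a + v2 * b) X p *
          (dird (w1, w2, w1 * a + w2 * b) T p * h21 + dird (w1, w2, w1 * a + w2 * b) X p * h22)) \<and>
    g1 = A' (T p, X p) * h22 + (2 * Dx A' (T p, X p) + B' (T p, X p)) * g2
      + (Dx (Dx A') (T p, X p) + Dx B' (T p, X p)) * U p"

lemma jet_relationsD:
  assumes "jet_relations p a b c d g1 g2 h11 h12 h21 h22"
  shows "dird (v1, v2, v1 * a + v2 * b) U p =
       dird (v1, v2, v1 * a + v2 * b) T p * g1 + dird (v1, v2, v1 * a + v2 * b) X p * g2"
    "dird (w1, w2, w1 * a + w2 * b) (dird (v1, v2, v1 * a + v2 * b) U) p + (v1 * w1 * d + v2 * w2 * c) * Su U p =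
       (dird (w1, w2, w1 * a + w2 * b) (dird (v1, v2, v1 * a + v2 * b) T) p + (v1 * w1 * d + v2 * w2 * c) * Su T p) * g1
       + (dird (w1, w2, w1 * a + w2 * b) (dird (v1, v2, v1 * a + v2 * b) X) p + (v1 * w1 * d + v2 * w2 * c) * Su X p) * g2
       + dird (v1, v2, v1 * a + v2 * b) T p *
          (dird (w1, w2, w1 * a + w2 * b) T p * h11 + dird (w1, w2, w1 * a + w2 * b) X p * h12)
       + dird (v1, v2, v1 * a + v2 * b) X p *
          (dird (w1, w2, w1 * a + w2 * b) T p * h21 + dird (w1, w2, w1 * a + w2 * b) X p * h22)"
    "g1 = A' (T p, X p) * h22 + (2 * Dx A' (T p, X p) + B' (T p, X p)) * g2
      + (Dx (Dx A') (T p, X p) + Dx B' (T p, X p)) * U p"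
  using assms unfolding jet_relations_def by blast+

end

section \<open>Test functions carried by a connecting transformation\<close>

locale fp_connection = fp_transformation +
  assumes connects: "connects_fokker_planck W \<Phi> A B A' B'"
begin

text \<open>At a nondegenerate 1-jet the image of the graph is locally a graph, so the connection
  hypothesis applies; both equations are then read as vanishing residuals.\<close>

lemma connect_graph:
  assumes f: "smooth_on UNIV f" and p0: "(fst q0, snd q0, f q0) \<in> W"
    and J: "jacobian (fst q0, snd q0, f q0) (Dt f q0) (Dx f q0) \<noteq> 0"
  obtains S S' g where "open S" "open S'" "q0 \<in> S" "smooth_on S' g" "S \<subseteq> D" "S' \<subseteq> D'"
    "\<And>q. q \<in> S \<Longrightarrow> (fst q, snd q, f q) \<in> W"
    "\<And>q. q \<in> S \<Longrightarrow> (T (fst q, snd q, f q), X (fst q, snd q, f q)) \<in> S'"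
    "\<And>q. q \<in> S \<Longrightarrow> g (T (fst q, snd q, f q), X (fst q, snd q, f q)) = U (fst q, snd q, f q)"
    "fp_residual A B f q0 = 0 \<longleftrightarrow>
      fp_residual A' B' g (T (fst q0, snd q0, f q0), X (fst q0, snd q0, f q0)) = 0"
proof -
  let ?p = "(fst q0, snd q0, f q0)"
  have df: "f differentiable at q0" using smooth_on_differentiable[OF f] by blast
  have d1: "Dt (\<lambda>q. F (fst q, snd q, f q)) q0 = dird (1, 0, Dt f q0) F ?p"
    "Dx (\<lambda>q. F (fst q, snd q, f q)) q0 = dird (0, 1, Dx f q0) F ?p" if "F differentiable at ?p"
    for F :: "space \<Rightarrow> real"
    using dird_graph[OF df that] by simp_all
  have J': "Dt (\<lambda>q. T (fst q, snd q, f q)) q0 * Dx (\<lambda>q. X (fst q, snd q, f q)) q0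
      - Dx (\<lambda>q. T (fst q, snd q, f q)) q0 * Dt (\<lambda>q. X (fst q, snd q, f q)) q0 \<noteq> 0"
    using J[unfolded jacobian_eq[OF p0]]
    by (simp only: d1[OF differentiable_TXU(1)[OF p0]] d1[OF differentiable_TXU(2)[OF p0]] not_False_eq_True)
  obtain S S' g where g: "open S" "open S'" "q0 \<in> S" "smooth_on S' g" "graph_over S f \<subseteq> W"
    "\<Phi> ` graph_over S f = graph_over S' g"
    by (rule graph_transform[OF open_W smooth_T smooth_X smooth_U \<Phi>_eq f p0 J'])
  have SW: "(fst q, snd q, f q) \<in> W" if "q \<in> S" for q
    using g(5) that by (auto simp: graph_over_def case_prod_unfold)
  have SD: "S \<subseteq> D" using in_D[OF SW] by auto
  have S'D': "S' \<subseteq> D'"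
  proof
    fix y assume "y \<in> S'"
    then have "(fst y, snd y, g y) \<in> \<Phi> ` graph_over S f"
      unfolding g(6) by (auto simp: graph_over_def case_prod_unfold)
    then obtain p where "p \<in> W" "\<Phi> p = (fst y, snd y, g y)" using g(5) by force
    then show "y \<in> D'" using in_D'[of p] \<Phi>_eq[of p] by simp
  qed
  note im = graph_over_image[OF g(6) _ \<Phi>_eq]
  have fS: "smooth_on S f" using f smooth_on_subset by blast
  have "fokker_planck_at A B f q0 \<longleftrightarrow> fokker_planck_at A' B' g (T ?p, X ?p)"
    using connects[unfolded connects_fokker_planck_def, rule_format, of S S' f g "fst q0" "snd q0" "T ?p" "X ?p" "U ?p"]
      g fS \<Phi>_eq[of ?p] by simp
  moreover have "fokker_planck_at A B f q0 \<longleftrightarrow> fp_residual A B f q0 = 0"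
    using coefficients(2,3) SD smooth_on_subset
    by (intro fokker_planck_at_iff_residual[OF g(1) _ _ fS g(3)]) blast+
  moreover have "fokker_planck_at A' B' g (T ?p, X ?p) \<longleftrightarrow> fp_residual A' B' g (T ?p, X ?p) = 0"
    using coefficients(5,6) S'D' smooth_on_subset
    by (intro fokker_planck_at_iff_residual[OF g(2) _ _ g(4) im(1)[OF g(3)]]) blast+
  ultimately show thesis
    using im by (intro that[OF g(1-4) SD S'D' SW]) simp_all
qed

text \<open>The hypothesis on \<open>a\<close> makes the quadratic test function satisfy the source
  equation at the base point, so its image satisfies the target equation there. The second
  t-derivative \<open>d\<close> does not enter this condition and stays free.\<close>

lemma connect_jet:
  assumes p: "p = (t, x, u)" "p \<in> W"
    and J: "jacobian p a b \<noteq> 0"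
    and a: "a = A (t, x) * c + (2 * Dx A (t, x) + B (t, x)) * b + (Dx (Dx A) (t, x) + Dx B (t, x)) * u"
  obtains g1 g2 h11 h12 h21 h22 where "jet_relations p a b c d g1 g2 h11 h12 h21 h22"
proof -
  define q0 where "q0 = (t, x)"
  define f where "f = jet q0 u a b c d"
  have f: "smooth_on UNIV f" by (simp add: f_def jet_smooth)
  have f0: "f q0 = u" by (simp add: f_def jet_0)
  have p0: "(fst q0, snd q0, f q0) = p" by (simp add: p q0_def f0[unfolded q0_def])
  have f1: "dird v f q0 = fst v * a + snd v * b" for v
    by (simp add: f_def jet_dird)
  have f2: "dird w (dird v f) q0 = fst v * fst w * d + snd v * snd w * c" for v w
    by (simp add: f_def jet_dird_dird)
  have pW: "(fst q0, snd q0, f q0) \<in> W" using p(2) p0 by simp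
  have Jf: "jacobian (fst q0, snd q0, f q0) (Dt f q0) (Dx f q0) \<noteq> 0"
    using J unfolding p0 f1 by simp
  obtain S S' g where g: "open S" "open S'" "q0 \<in> S" "smooth_on S' g" "S \<subseteq> D" "S' \<subseteq> D'"
    "\<And>q. q \<in> S \<Longrightarrow> (fst q, snd q, f q) \<in> W"
    "\<And>q. q \<in> S \<Longrightarrow> (T (fst q, snd q, f q), X (fst q, snd q, f q)) \<in> S'"
    "\<And>q. q \<in> S \<Longrightarrow> g (T (fst q, snd q, f q), X (fst q, snd q, f q)) = U (fst q, snd q, f q)"
    "fp_residual A B f q0 = 0 \<longleftrightarrow>
      fp_residual A' B' g (T (fst q0, snd q0, f q0), X (fst q0, snd q0, f q0)) = 0"
    by (rule connect_graph[OF f pW Jf]) (rule that)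
  define y where "y = (T p, X p)"
  have fS: "smooth_on S f" using f smooth_on_subset by blast
  note lift = smooth_on_graph[OF g(1) fS open_W _ g(7)]
  have y: "y \<in> S'" using g(8)[OF g(3)] p0 by (simp add: y_def)
  have L1: "dird v (\<lambda>q. F (fst q, snd q, f q)) q0 = dird (fst v, snd v, fst v * a + snd v * b) F p"
    if "smooth_on W F" for F :: "space \<Rightarrow> real" and v
    using dird_graph[OF smooth_on_differentiable[OF fS g(3)] smooth_on_differentiable[OF that g(7)[OF g(3)]], of v]
    unfolding f1 p0 .
  have L2: "dird w (dird v (\<lambda>q. F (fst q, snd q, f q))) q0 =
      dird (fst w, snd w, fst w * a + snd w * b) (dird (fst v, snd v, fst v * a + snd v * b) F) p
      + (fst v * fst w * d + snd v * snd w * c) * Su F p"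
    if "smooth_on W F" for F :: "space \<Rightarrow> real" and v w
    using dird_dird_graph[OF g(1) fS open_W that g(7) g(3), of w v] unfolding f1 f2 p0 .
  have G1: "dird v (\<lambda>q. U (fst q, snd q, f q)) q0 =
      dird v (\<lambda>q. T (fst q, snd q, f q)) q0 * Dt g y + dird v (\<lambda>q. X (fst q, snd q, f q)) q0 * Dx g y" for v
  proof -
    have "dird v (\<lambda>q. U (fst q, snd q, f q)) q0 =
        dird v (\<lambda>q. g (T (fst q, snd q, f q), X (fst q, snd q, f q))) q0"
      by (rule dird_cong[OF g(1,3) g(9)[symmetric]])
    then show ?thesis
      using dird_comp_plane[OF smooth_on_differentiable[OF lift[OF smooth_T] g(3)]
          smooth_on_differentiable[OF lift[OF smooth_X] g(3)] smooth_on_differentiable[OF g(4) g(8)[OF g(3)]], of v]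
      unfolding p0 y_def by (rule trans)
  qed
  have G2: "dird w (dird v (\<lambda>q. U (fst q, snd q, f q))) q0 =
      dird w (dird v (\<lambda>q. T (fst q, snd q, f q))) q0 * Dt g y + dird w (dird v (\<lambda>q. X (fst q, snd q, f q))) q0 * Dx g y
      + dird v (\<lambda>q. T (fst q, snd q, f q)) q0 *
        (dird w (\<lambda>q. T (fst q, snd q, f q)) q0 * Dt (Dt g) y + dird w (\<lambda>q. X (fst q, snd q, f q)) q0 * Dx (Dt g) y)
      + dird v (\<lambda>q. X (fst q, snd q, f q)) q0 *
        (dird w (\<lambda>q. T (fst q, snd q, f q)) q0 * Dt (Dx g) y + dird w (\<lambda>q. X (fst q, snd q, f q)) q0 * Dx (Dx g) y)"
    for v w
  proof -
    have "dird w (dird v (\<lambda>q. U (fst q, snd q, f q))) q0 =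
        dird w (dird v (\<lambda>q. g (T (fst q, snd q, f q), X (fst q, snd q, f q)))) q0"
      by (rule dird_cong[OF g(1,3)], rule dird_cong[OF g(1) _ g(9)[symmetric]])
    then show ?thesis
      using dird_dird_comp_plane[OF g(1) lift[OF smooth_T] lift[OF smooth_X] g(3) g(2,4,8), of w v]
      unfolding p0 y_def by (rule trans)
  qed
  have "fp_residual A B f q0 = 0"
    unfolding fp_residual_def f0 f1 f2 using a by (simp add: q0_def)
  then have "fp_residual A' B' g y = 0" using g(10) by (simp only: p0 y_def)
  moreover have "g y = U p" using g(9)[OF g(3)] unfolding p0 y_def .
  ultimately have R: "Dt g y = A' y * Dx (Dx g) y + (2 * Dx A' y + B' y) * Dx g y + (Dx (Dx A') y + Dx B' y) * U p"
    unfolding fp_residual_def by simp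
  have "jet_relations p a b c d (Dt g y) (Dx g y) (Dt (Dt g) y) (Dx (Dt g) y) (Dt (Dx g) y) (Dx (Dx g) y)"
    unfolding jet_relations_def
  proof (intro conjI allI)
    fix v1 v2 w1 w2 :: real
    show "dird (v1, v2, v1 * a + v2 * b) U p =
       dird (v1, v2, v1 * a + v2 * b) T p * Dt g y + dird (v1, v2, v1 * a + v2 * b) X p * Dx g y"
      using G1[of "(v1, v2)"] unfolding L1[OF smooth_T] L1[OF smooth_X] L1[OF smooth_U] by simp
    show "dird (w1, w2, w1 * a + w2 * b) (dird (v1, v2, v1 * a + v2 * b) U) p + (v1 * w1 * d + v2 * w2 * c) * Su U p =
       (dird (w1, w2, w1 * a + w2 * b) (dird (v1, v2, v1 * a + v2 * b) T) p + (v1 * w1 * d + v2 * w2 * c) * Su T p) * Dt g y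
       + (dird (w1, w2, w1 * a + w2 * b) (dird (v1, v2, v1 * a + v2 * b) X) p + (v1 * w1 * d + v2 * w2 * c) * Su X p) * Dx g y
       + dird (v1, v2, v1 * a + v2 * b) T p *
          (dird (w1, w2, w1 * a + w2 * b) T p * Dt (Dt g) y + dird (w1, w2, w1 * a + w2 * b) X p * Dx (Dt g) y)
       + dird (v1, v2, v1 * a + v2 * b) X p *
          (dird (w1, w2, w1 * a + w2 * b) T p * Dt (Dx g) y + dird (w1, w2, w1 * a + w2 * b) X p * Dx (Dx g) y)"
      using G2[of "(w1, w2)" "(v1, v2)"]
      unfolding L1[OF smooth_T] L1[OF smooth_X] L2[OF smooth_T] L2[OF smooth_X] L2[OF smooth_U] fst_conv snd_conv .
  qed (use R in \<open>simp add: y_def\<close>)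
  then show thesis by (rule that)
qed

end

section \<open>Gradients forced by the comparison of jets\<close>

context fp_connection
begin

text \<open>This number is the factor with which second derivatives of \<open>f\<close> enter those
  of \<open>g\<close>. If it vanished, the gradient of \<open>U\<close> would be \<open>g1\<close>
  times that of \<open>T\<close> plus \<open>g2\<close> times that of \<open>X\<close>.\<close>

lemma graph_normal_nonzero:
  assumes p: "p \<in> W" and g: "\<And>v1 v2. dird (v1, v2, v1 * a + v2 * b) U p =
       dird (v1, v2, v1 * a + v2 * b) T p * g1 + dird (v1, v2, v1 * a + v2 * b) X p * g2"
  shows "Su U p - Su T p * g1 - Su X p * g2 \<noteq> 0"
proof
  assume n: "Su U p - Su T p * g1 - Su X p * g2 = 0"
  note s = dird_space[OF differentiable_TXU(1)[OF p]] dird_space[OF differentiable_TXU(2)[OF p]]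
    dird_space[OF differentiable_TXU(3)[OF p]]
  have gt: "St U p + a * Su U p = (St T p + a * Su T p) * g1 + (St X p + a * Su X p) * g2"
    using g[of 1 0] s[of 1 0 a] by simp
  have gx: "Sx U p + b * Su U p = (Sx T p + b * Su T p) * g1 + (Sx X p + b * Su X p) * g2"
    using g[of 0 1] s[of 0 1 b] by simp
  have U': "Su U p = Su T p * g1 + Su X p * g2" using n by simp
  have "(- g1) * St T p + (- g2) * St X p + 1 * St U p = 0"
    using gt unfolding U' by (simp add: algebra_simps)
  moreover have "(- g1) * Sx T p + (- g2) * Sx X p + 1 * Sx U p = 0"
    using gx unfolding U' by (simp add: algebra_simps)
  moreover have "(- g1) * Su T p + (- g2) * Su X p + 1 * Su U p = 0"
    unfolding U' by (simp add: algebra_simps)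
  ultimately have "(1::real) = 0" by (rule gradients_independent(3)[OF p])
  then show False by simp
qed

text \<open>Two solution jets differing only in u_tt have images with the same \<open>g1\<close> and
  \<open>g2\<close>, and then the target equation forces the same \<open>h22\<close>. So the
  difference of the image Hessians has no xx-part, and it pulls back to \<open>\<kappa>\<close>
  times the square of dt.\<close>

lemma Sx_T_on_jets:
  assumes p: "p \<in> W" and J: "jacobian p a b \<noteq> 0"
  shows "Sx T p + b * Su T p = 0"
proof -
  obtain t x u where ptx: "p = (t, x, u)" by (rule prod_cases3)
  have A0: "A (t, x) \<noteq> 0" using coefficients(7) in_D p ptx by blast
  have A'0: "A' (T p, X p) \<noteq> 0" using coefficients(8) in_D' p by blast
  \<comment> \<open>The source equation solved for u_xx, with \<open>a\<close> and \<open>b\<close>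
    given.\<close>
  define c where "c = (a - (2 * Dx A (t, x) + B (t, x)) * b - (Dx (Dx A) (t, x) + Dx B (t, x)) * u) / A (t, x)"
  have ac: "a = A (t, x) * c + (2 * Dx A (t, x) + B (t, x)) * b + (Dx (Dx A) (t, x) + Dx B (t, x)) * u"
    using A0 by (simp add: c_def)
  note jet = connect_jet[OF ptx p J ac]
  obtain g1 g2 h11 h12 h21 h22 where "jet_relations p a b c 0 g1 g2 h11 h12 h21 h22"
    by (rule jet[where d = 0]) (rule that)
  note j = jet_relationsD[OF this]
  obtain g1' g2' h11' h12' h21' h22' where "jet_relations p a b c 1 g1' g2' h11' h12' h21' h22'"
    by (rule jet[where d = 1]) (rule that)
  note j' = jet_relationsD[OF this]
  define Pt where "Pt = dird (1, 0, a) T p"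
  define Px where "Px = dird (0, 1, b) T p"
  define Qt where "Qt = dird (1, 0, a) X p"
  define Qx where "Qx = dird (0, 1, b) X p"
  have J': "Pt * Qx - Px * Qt \<noteq> 0"
    using J by (simp add: jacobian_eq[OF p] Pt_def Px_def Qt_def Qx_def)
  have "Pt * g1 + Qt * g2 = Pt * g1' + Qt * g2'" "Px * g1 + Qx * g2 = Px * g1' + Qx * g2'"
    using j(1)[of 1 0] j'(1)[of 1 0] j(1)[of 0 1] j'(1)[of 0 1] by (simp_all add: Pt_def Px_def Qt_def Qx_def)
  then have "(Pt * Qx - Px * Qt) * (g1' - g1) = 0" "(Pt * Qx - Px * Qt) * (g2' - g2) = 0"
    by algebra+
  then have g: "g1' = g1" "g2' = g2" using J' by simp_all
  have h: "h22' = h22" using j(3) j'(3) A'0 unfolding g by simp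
  define d11 where "d11 = h11' - h11"
  define d12 where "d12 = h12' - h12"
  define d21 where "d21 = h21' - h21"
  define \<kappa> where "\<kappa> = Su U p - Su T p * g1 - Su X p * g2"
  have tt: "Pt * (Pt * d11 + Qt * d12) + Qt * (Pt * d21) = \<kappa>"
    using j(2)[of 1 0 1 0] j'(2)[of 1 0 1 0] unfolding g h
    by (simp add: Pt_def[symmetric] Qt_def[symmetric] d11_def d12_def d21_def \<kappa>_def algebra_simps)
  have tx: "Pt * (Px * d11 + Qx * d12) + Qt * (Px * d21) = 0"
    using j(2)[of 0 1 1 0] j'(2)[of 0 1 1 0] unfolding g h
    by (simp add: Pt_def[symmetric] Qt_def[symmetric] Px_def[symmetric] Qx_def[symmetric] d11_def d12_def d21_def algebra_simps)
  have xt: "Px * (Pt * d11 + Qt * d12) + Qx * (Pt * d21) = 0"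
    using j(2)[of 1 0 0 1] j'(2)[of 1 0 0 1] unfolding g h
    by (simp add: Pt_def[symmetric] Qt_def[symmetric] Px_def[symmetric] Qx_def[symmetric] d11_def d12_def d21_def algebra_simps)
  have xx: "Px * (Px * d11 + Qx * d12) + Qx * (Px * d21) = 0"
    using j(2)[of 0 1 0 1] j'(2)[of 0 1 0 1] unfolding g h
    by (simp add: Px_def[symmetric] Qx_def[symmetric] d11_def d12_def d21_def algebra_simps)
  \<comment> \<open>The pulled-back form is evaluated at the vector \<open>(Px, - Pt)\<close>. The
    total derivative of \<open>T\<close> along it vanishes, so a form without xx-part is zero there,
    while the other side is \<open>Px * Px * \<kappa>\<close>.\<close>
  have "0 = Px * Px * (Pt * (Pt * d11 + Qt * d12) + Qt * (Pt * d21))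
      - Pt * Px * (Pt * (Px * d11 + Qx * d12) + Qt * (Px * d21))
      - Pt * Px * (Px * (Pt * d11 + Qt * d12) + Qx * (Pt * d21))
      + Pt * Pt * (Px * (Px * d11 + Qx * d12) + Qx * (Px * d21))"
    by (simp add: algebra_simps)
  then have "0 = Px * Px * \<kappa>" unfolding tt tx xt xx by simp
  moreover have "\<kappa> \<noteq> 0"
    unfolding \<kappa>_def by (rule graph_normal_nonzero[OF p j(1)])
  ultimately have "Px = 0" by simp
  then show ?thesis
    using dird_space[OF differentiable_TXU(1)[OF p], of 0 1 b] by (simp add: Px_def)
qed

text \<open>Being affine in the x-slope, a Jacobian determinant that is nonzero at \<open>b\<close>
  is also nonzero at \<open>b + 1\<close> or at \<open>b + 2\<close>. Two admissible slopes
  annihilate both coefficients of \<open>Sx T p + b * Su T p\<close>.\<close>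

lemma T_gradient:
  assumes p: "p \<in> W"
  shows "Sx T p = 0" "Su T p = 0" "St T p \<noteq> 0"
proof -
  obtain a b where J: "jacobian p a b \<noteq> 0" using jacobian_nonzero[OF p] .
  have "jacobian p a (b + 1) - jacobian p a b = jacobian p a (b + 2) - jacobian p a (b + 1)"
    by (simp add: jacobian_def algebra_simps)
  then have "jacobian p a (b + 1) \<noteq> 0 \<or> jacobian p a (b + 2) \<noteq> 0" using J by linarith
  then have "Sx T p + (b + 1) * Su T p = 0 \<or> Sx T p + (b + 2) * Su T p = 0"
    using Sx_T_on_jets[OF p] by blast
  then show u: "Su T p = 0" using Sx_T_on_jets[OF p J] by (auto simp: algebra_simps)
  then show x: "Sx T p = 0" using Sx_T_on_jets[OF p J] by simp
  show "St T p \<noteq> 0" using J u x by (auto simp: jacobian_def)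
qed

lemma dird_T_zero:
  assumes p: "p \<in> W"
  shows "dird (0, v2, v3) T p = 0" "dird w (dird (0, v2, v3) T) p = 0"
proof -
  have 0: "dird (0, v2, v3) T q = 0" if "q \<in> W" for q
    using dird_space[OF differentiable_TXU(1)[OF that], of 0 v2 v3] T_gradient[OF that] by simp
  then show "dird (0, v2, v3) T p = 0" using p .
  show "dird w (dird (0, v2, v3) T) p = 0"
    using dird_cong[where v = w, OF open_W p 0] by (simp add: dird_const)
qed

text \<open>Solution jets with u_xx = 0 and u_xx = 1 are compared, so u_t changes by
  \<open>A (t, x)\<close>. The change of \<open>g1\<close> is \<open>A (t, x) * \<kappa>\<close>
  over \<open>St T p\<close>, that of \<open>h22\<close> is \<open>\<kappa>\<close> over the square
  of the total x-derivative of \<open>X\<close>, and the target equation makes the first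
  \<open>A'\<close> times the second.\<close>

lemma leading_coefficient_on_jets:
  assumes p: "p \<in> W" "p = (t, x, u)" and b: "Sx X p + b * Su X p \<noteq> 0"
  shows "A (t, x) * (Sx X p + b * Su X p)\<^sup>2 = St T p * A' (T p, X p)"
proof -
  define a0 where "a0 = (2 * Dx A (t, x) + B (t, x)) * b + (Dx (Dx A) (t, x) + Dx B (t, x)) * u"
  have J: "jacobian p a b \<noteq> 0" for a
    using b T_gradient[OF p(1)] by (simp add: jacobian_def)
  define a where "a = a0 + A (t, x)"
  note jet = connect_jet[OF p(2,1) J]
  have ac: "a0 = A (t, x) * 0 + (2 * Dx A (t, x) + B (t, x)) * b + (Dx (Dx A) (t, x) + Dx B (t, x)) * u"
    "a = A (t, x) * 1 + (2 * Dx A (t, x) + B (t, x)) * b + (Dx (Dx A) (t, x) + Dx B (t, x)) * u"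
    by (simp_all add: a_def a0_def)
  obtain g1 g2 h11 h12 h21 h22 where "jet_relations p a0 b 0 0 g1 g2 h11 h12 h21 h22"
    by (rule jet[OF ac(1), where d = 0]) (rule that)
  note j = jet_relationsD[OF this]
  obtain g1' g2' h11' h12' h21' h22' where "jet_relations p a b 1 0 g1' g2' h11' h12' h21' h22'"
    by (rule jet[OF ac(2), where d = 0]) (rule that)
  note j' = jet_relationsD[OF this]
  define Qx where "Qx = Sx X p + b * Su X p"
  define \<kappa> where "\<kappa> = Su U p - Su X p * g2"
  have Qx: "dird (0, 1, b) X p = Qx"
    using dird_space[OF differentiable_TXU(2)[OF p(1)], of 0 1 b] by (simp add: Qx_def)
  note T0 = dird_T_zero[OF p(1)]
  \<comment> \<open>Since the total x-derivative of \<open>T\<close> vanishes, \<open>g2\<close> is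
    determined by the slope \<open>b\<close>, which both jets share.\<close>
  have g2: "g2' = g2"
    using j(1)[of 0 1] j'(1)[of 0 1] b by (simp add: T0 Qx) (simp add: Qx_def)
  have U1: "St U p + a0 * Su U p = St T p * g1 + (St X p + a0 * Su X p) * g2"
    using j(1)[of 1 0] T_gradient[OF p(1)] dird_space[OF differentiable_TXU(1)[OF p(1)], of 1 0 a0]
      dird_space[OF differentiable_TXU(2)[OF p(1)], of 1 0 a0] dird_space[OF differentiable_TXU(3)[OF p(1)], of 1 0 a0]
    by simp
  have U2: "St U p + a * Su U p = St T p * g1' + (St X p + a * Su X p) * g2"
    using j'(1)[of 1 0] T_gradient[OF p(1)] dird_space[OF differentiable_TXU(1)[OF p(1)], of 1 0 a]
      dird_space[OF differentiable_TXU(2)[OF p(1)], of 1 0 a] dird_space[OF differentiable_TXU(3)[OF p(1)], of 1 0 a]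
    by (simp add: g2)
  have t: "A (t, x) * \<kappa> = St T p * (g1' - g1)"
    using U1 U2 by (simp add: a_def \<kappa>_def algebra_simps)
  have xx: "\<kappa> = Qx * Qx * (h22' - h22)"
    using j(2)[of 0 1 0 1] j'(2)[of 0 1 0 1] T_gradient[OF p(1)]
    by (simp add: T0 Qx g2 \<kappa>_def algebra_simps)
  have r: "g1' - g1 = A' (T p, X p) * (h22' - h22)"
    unfolding j(3) j'(3) g2 by (simp add: algebra_simps)
  have "\<kappa> \<noteq> 0"
    using graph_normal_nonzero[OF p(1) j(1)] T_gradient[OF p(1)] by (simp add: \<kappa>_def)
  then have n: "h22' - h22 \<noteq> 0" using xx by auto
  have "(h22' - h22) * (A (t, x) * Qx\<^sup>2) = (h22' - h22) * (St T p * A' (T p, X p))"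
    using t unfolding xx r by (simp add: algebra_simps power2_eq_square)
  then show ?thesis using n by (simp add: Qx_def)
qed

text \<open>If \<open>Su X p\<close> were nonzero, \<open>Sx X p + b * Su X p\<close> would take
  every nonzero value as \<open>b\<close> varies, while the relation between the leading
  coefficients fixes its square.\<close>

lemma X_gradient:
  assumes p: "p \<in> W"
  shows "Su X p = 0" "Sx X p \<noteq> 0"
proof -
  obtain t x u where ptx: "p = (t, x, u)" by (rule prod_cases3)
  have A0: "A (t, x) \<noteq> 0" using coefficients(7) in_D p ptx by blast
  show u: "Su X p = 0"
  proof (rule ccontr)
    assume n: "Su X p \<noteq> 0"
    have "A (t, x) * s\<^sup>2 = St T p * A' (T p, X p)" if "s \<noteq> 0" for s
    proof -
      have "Sx X p + ((s - Sx X p) / Su X p) * Su X p = s" using n by simp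
      then show ?thesis
        using leading_coefficient_on_jets[OF p ptx, of "(s - Sx X p) / Su X p"] that by metis
    qed
    from this[of 1] this[of 2] have "A (t, x) = 0" by simp
    then show False using A0 by simp
  qed
  show "Sx X p \<noteq> 0"
    using jacobian_nonzero[OF p] u T_gradient[OF p] by (auto simp: jacobian_def)
qed

lemma leading_coefficient:
  assumes "(t, x, u) \<in> W"
  shows "A (t, x) * (Sx X (t, x, u))\<^sup>2 = St T (t, x, u) * A' (T (t, x, u), X (t, x, u))"
  using leading_coefficient_on_jets[OF assms refl, of 0] X_gradient[OF assms] by simp

text \<open>For solution jets with u_xx = 0, the numbers u_t, \<open>g2\<close>, \<open>g1\<close>
  and, through the target equation, \<open>h\<close> depend affinely on the slope \<open>b\<close>.
  The xx-relation then equates a quadratic in \<open>b\<close> with leading coefficient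
  \<open>Su (Su U) p\<close> to an affine function.\<close>

lemma Su_Su_U:
  assumes p: "p \<in> W"
  shows "Su (Su U) p = 0"
proof -
  obtain t x u where ptx: "p = (t, x, u)" by (rule prod_cases3)
  have A'0: "A' (T p, X p) \<noteq> 0" using coefficients(8) in_D' p by blast
  define k where "k b = (2 * Dx A (t, x) + B (t, x)) * b + (Dx (Dx A) (t, x) + Dx B (t, x)) * u" for b
  define Xx where "Xx = Sx X p"
  have Xx: "Xx \<noteq> 0" using X_gradient[OF p] by (simp add: Xx_def)
  have Tt: "St T p \<noteq> 0" by (rule T_gradient(3)[OF p])
  have d2: "dird (0, 1, b) (dird (0, 1, b) F) p = Sx (Sx F) p + 2 * b * Su (Sx F) p + b\<^sup>2 * Su (Su F) p"
    if F: "smooth_on W F" for F :: "space \<Rightarrow> real" and b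
  proof -
    note F1 = smooth_on_dird[OF F] note d = smooth_on_differentiable[OF F] smooth_on_differentiable[OF F1]
    have "dird (0, 1, b) F q = Sx F q + b * Su F q" if "q \<in> W" for q
      using dird_space[OF d(1)[OF that], of 0 1 b] by simp
    then have "dird (0, 1, b) (dird (0, 1, b) F) p = dird (0, 1, b) (\<lambda>q. Sx F q + b * Su F q) p"
      by (rule dird_cong[OF open_W p])
    moreover have "dird (0, 1, b) (\<lambda>q. Sx F q + b * Su F q) p = dird (0, 1, b) (Sx F) p + dird (0, 1, b) (\<lambda>q. b * Su F q) p"
      by (intro dird_add smooth_on_differentiable[of W] smooth_on_mult smooth_on_const F1 open_W p)
    moreover have "dird (0, 1, b) (\<lambda>q. b * Su F q) p = b * dird (0, 1, b) (Su F) p"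
      by (rule dird_bounded_linear[OF bounded_linear_mult_right d(2)[OF p]])
    ultimately show ?thesis
      using dird_space[OF d(2)[OF p], of 0 1 b "(0, 1, 0)"] dird_space[OF d(2)[OF p], of 0 1 b "(0, 0, 1)"]
        dird_commute[OF open_W F p, of "(0, 1, 0)" "(0, 0, 1)"]
      by (simp add: algebra_simps power2_eq_square)
  qed
  \<comment> \<open>\<open>Su X\<close> vanishes on all of \<open>W\<close>, hence so do its
    derivatives; symmetry of mixed derivatives gives the first claim.\<close>
  have X0: "Su (Sx X) p = 0" "Su (Su X) p = 0"
    using dird_cong[where v = "(0, 1, 0)", OF open_W p X_gradient(1)]
      dird_cong[where v = "(0, 0, 1)", OF open_W p X_gradient(1)]
      dird_commute[OF open_W smooth_X p, of "(0, 1, 0)" "(0, 0, 1)"]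
    by (simp_all add: dird_const)
  have "\<exists>g1 g2 h. St U p + k b * Su U p = St T p * g1 + St X p * g2
      \<and> Sx U p + b * Su U p = Xx * g2
      \<and> Sx (Sx U) p + 2 * b * Su (Sx U) p + b\<^sup>2 * Su (Su U) p = Sx (Sx X) p * g2 + Xx * Xx * h
      \<and> g1 = A' (T p, X p) * h + (2 * Dx A' (T p, X p) + B' (T p, X p)) * g2
          + (Dx (Dx A') (T p, X p) + Dx B' (T p, X p)) * U p" for b
  proof -
    have J: "jacobian p (k b) b \<noteq> 0"
      using T_gradient[OF p] X_gradient[OF p] by (simp add: jacobian_def)
    have kb: "k b = A (t, x) * 0 + (2 * Dx A (t, x) + B (t, x)) * b + (Dx (Dx A) (t, x) + Dx B (t, x)) * u"
      by (simp add: k_def)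
    obtain g1 g2 h11 h12 h21 h22 where "jet_relations p (k b) b 0 0 g1 g2 h11 h12 h21 h22"
      by (rule connect_jet[OF ptx p J kb, where d = 0]) (rule that)
    note j = jet_relationsD[OF this]
    have X1: "dird (0, 1, b) X p = Xx"
      using dird_space[OF differentiable_TXU(2)[OF p], of 0 1 b] X_gradient[OF p] by (simp add: Xx_def)
    have "St U p + k b * Su U p = St T p * g1 + St X p * g2"
      using j(1)[of 1 0] T_gradient[OF p] X_gradient(1)[OF p] dird_space[OF differentiable_TXU(1)[OF p], of 1 0 "k b"]
        dird_space[OF differentiable_TXU(2)[OF p], of 1 0 "k b"] dird_space[OF differentiable_TXU(3)[OF p], of 1 0 "k b"]
      by simp
    moreover have "Sx U p + b * Su U p = Xx * g2"
      using j(1)[of 0 1] dird_space[OF differentiable_TXU(3)[OF p], of 0 1 b]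
      by (simp add: X1 dird_T_zero[OF p])
    moreover have "Sx (Sx U) p + 2 * b * Su (Sx U) p + b\<^sup>2 * Su (Su U) p = Sx (Sx X) p * g2 + Xx * Xx * h22"
      using j(2)[of 0 1 0 1] d2[OF smooth_U, of b] d2[OF smooth_X, of b]
      by (simp add: X1 X0 dird_T_zero[OF p])
    ultimately show ?thesis using j(3) by blast
  qed
  note ex = this
  obtain g1 g2 h where e0: "St U p + k 0 * Su U p = St T p * g1 + St X p * g2"
      "Sx U p = Xx * g2"
      "Sx (Sx U) p = Sx (Sx X) p * g2 + Xx * Xx * h"
      "g1 = A' (T p, X p) * h + (2 * Dx A' (T p, X p) + B' (T p, X p)) * g2
          + (Dx (Dx A') (T p, X p) + Dx B' (T p, X p)) * U p"
    using ex[of 0] by auto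
  obtain g1p g2p hp where ep: "St U p + k 1 * Su U p = St T p * g1p + St X p * g2p"
      "Sx U p + Su U p = Xx * g2p"
      "Sx (Sx U) p + 2 * Su (Sx U) p + Su (Su U) p = Sx (Sx X) p * g2p + Xx * Xx * hp"
      "g1p = A' (T p, X p) * hp + (2 * Dx A' (T p, X p) + B' (T p, X p)) * g2p
          + (Dx (Dx A') (T p, X p) + Dx B' (T p, X p)) * U p"
    using ex[of 1] by auto
  obtain g1m g2m hm where em: "St U p + k (- 1) * Su U p = St T p * g1m + St X p * g2m"
      "Sx U p - Su U p = Xx * g2m"
      "Sx (Sx U) p - 2 * Su (Sx U) p + Su (Su U) p = Sx (Sx X) p * g2m + Xx * Xx * hm"
      "g1m = A' (T p, X p) * hm + (2 * Dx A' (T p, X p) + B' (T p, X p)) * g2m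
          + (Dx (Dx A') (T p, X p) + Dx B' (T p, X p)) * U p"
    using ex[of "-1"] by auto
  \<comment> \<open>Second differences over the slopes -1, 0 and 1 vanish, in turn for
    \<open>g2\<close>, \<open>g1\<close> and \<open>h\<close>.\<close>
  have "Xx * (g2p + g2m - 2 * g2) = 0"
    using e0(2) ep(2) em(2) by (simp add: algebra_simps)
  then have g2: "g2p = 2 * g2 - g2m" using Xx by simp
  have "St T p * (g1p + g1m - 2 * g1) = 0"
    using e0(1) ep(1) em(1) unfolding g2 by (simp add: k_def algebra_simps)
  then have g1: "g1p + g1m - 2 * g1 = 0" using Tt by simp
  have "A' (T p, X p) * (hp + hm - 2 * h) = 0"
    using g1 unfolding e0(4) ep(4) em(4) g2 by (simp add: algebra_simps)
  then have h: "hp = 2 * h - hm" using A'0 by simp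
  show ?thesis
    using e0(3) ep(3) em(3) unfolding g2 h by (simp add: algebra_simps)
qed

end

section \<open>Affine transformations\<close>

lemma deriv_eq_Dt:
  assumes "T differentiable at t"
  shows "deriv T t = Dt (\<lambda>q. T (fst q)) (t, x)" "Dx (\<lambda>q. T (fst q)) (t, x) = 0"
proof -
  have "((\<lambda>s. T (0 + s *\<^sub>R 1)) has_real_derivative dird 1 T (0 + t *\<^sub>R 1)) (at t)"
    using assms by (intro has_real_derivative_line) simp
  then have "deriv T t = dird 1 T t" by (simp add: DERIV_imp_deriv)
  moreover have "dird v (\<lambda>q. T (fst q)) (t, x) = dird (fst v) T t" for v
  proof -
    have "(fst :: real \<times> real \<Rightarrow> real) differentiable at (t, x)"
      by (simp add: bounded_linear_fst bounded_linear_imp_differentiable)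
    then show ?thesis
      using dird_comp[of fst "(t, x)" T v] assms dird_linear_id[OF bounded_linear_fst, of v "(t, x)"] by simp
  qed
  moreover have "dird 0 T t = 0" using linear_0[OF linear_dird[OF assms]] .
  ultimately show "deriv T t = Dt (\<lambda>q. T (fst q)) (t, x)" "Dx (\<lambda>q. T (fst q)) (t, x) = 0"
    by simp_all
qed

text \<open>Everything is expressed over the projected domain \<open>K\<close>. Of the conditions to
  be determined only nondegeneracy is assumed, so both implications can use this setting.\<close>

locale affine_transformation =
  fixes K D' :: "(real \<times> real) set" and H :: "real set"
    and T :: "real \<Rightarrow> real" and X U1 U0 A B A' B' :: "real \<times> real \<Rightarrow> real"
  assumes sets: "open K" "open H" "open D'" "\<And>q. q \<in> K \<Longrightarrow> fst q \<in> H" "\<And>q. q \<in> K \<Longrightarrow> (T (fst q), X q) \<in> D'"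
    and smooth: "smooth_on H T" "smooth_on K X" "smooth_on K U1" "smooth_on K U0" "smooth_on K A" "smooth_on K B"
      "smooth_on D' A'" "smooth_on D' B'"
    and nondegenerate: "\<And>q. q \<in> K \<Longrightarrow> deriv T (fst q) * pd_x X q \<noteq> 0" "\<And>q. q \<in> K \<Longrightarrow> U1 q \<noteq> 0"
begin

definition "\<tau> q = T (fst q)"
text \<open>The drift for which the relation in \<open>fp_residual_transform\<close> holds.\<close>

definition "b q = (Dx (Dx X) q * A q + Dt \<tau> q * B' (\<tau> q, X q) + Dt X q) / Dx X q"
definition "\<psi> q = Dx X q * U1 q"
text \<open>Together with \<open>c0\<close> this is the pair of brackets in
  \<open>fp_residual_mult\<close>, taken for the drift \<open>b\<close> above.\<close>

definition "c1 q = \<psi> q * B q - 2 * Dx \<psi> q * A q - b q * \<psi> q"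
definition "c0 q = Dt \<psi> q + \<psi> q * Dx B q - 2 * Dx \<psi> q * Dx A q - Dx (Dx \<psi>) q * A q
  - (Dx b q * \<psi> q + b q * Dx \<psi> q)"
definition "r q = fp_residual A b (\<lambda>q. Dx X q * U0 q) q"

lemma smooth_\<tau>: "smooth_on K \<tau>"
  unfolding \<tau>_def[abs_def]
  by (rule smooth_on_comp[OF sets(1,2) _ smooth(1) smooth_on_fst[OF sets(1) smooth_on_ident[OF sets(1)]]])
    (use sets(4) in auto)

lemma \<tau>_derivatives: "q \<in> K \<Longrightarrow> Dt \<tau> q = deriv T (fst q)" "q \<in> K \<Longrightarrow> Dx \<tau> q = 0"
  using deriv_eq_Dt[OF smooth_on_differentiable[OF smooth(1) sets(4)], of q "snd q"]
  by (simp_all add: \<tau>_def[abs_def])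

lemma nonzero: "q \<in> K \<Longrightarrow> Dt \<tau> q \<noteq> 0" "q \<in> K \<Longrightarrow> Dx X q \<noteq> 0" "q \<in> K \<Longrightarrow> \<psi> q \<noteq> 0"
  using nondegenerate[of q] \<tau>_derivatives[of q] pd_smooth(2)[OF sets(1) smooth(2), of q]
  by (auto simp: \<psi>_def)

lemma smooth_b: "smooth_on K b" and smooth_\<psi>: "smooth_on K \<psi>" and smooth_quotient: "smooth_on K (\<lambda>q. U0 q / U1 q)"
proof -
  have B': "smooth_on K (\<lambda>q. B' (\<tau> q, X q))"
    by (rule smooth_on_comp[OF sets(1,3) _ smooth(8) smooth_on_Pair[OF sets(1) smooth_\<tau> smooth(2)]])
      (use sets(5) in \<open>auto simp: \<tau>_def\<close>)
  show "smooth_on K b" unfolding b_def[abs_def]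
    by (intro smooth_on_divide smooth_on_add smooth_on_mult smooth_on_dird sets smooth smooth_\<tau> B' nonzero)
  show "smooth_on K \<psi>" unfolding \<psi>_def[abs_def]
    by (intro smooth_on_mult smooth_on_dird sets smooth)
  show "smooth_on K (\<lambda>q. U0 q / U1 q)"
    by (intro smooth_on_divide sets smooth nondegenerate)
qed

lemma Dx_\<psi>: "q \<in> K \<Longrightarrow> Dx \<psi> q = Dx X q * Dx U1 q + Dx (Dx X) q * U1 q"
  unfolding \<psi>_def[abs_def] by (rule dird_mult_smooth[OF smooth_on_dird[OF smooth(2)] smooth(3)])

text \<open>\<open>c1 q\<close> is \<open>U1 q * Dt \<tau> q\<close> times the difference between
  the prescribed value of \<open>B'\<close> and the actual one.\<close>

lemma c1_eq_0_iff:
  assumes "q \<in> K"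
  shows "c1 q = 0 \<longleftrightarrow> B' (\<tau> q, X q) = Dx X q / Dt \<tau> q * (B q - 2 * (Dx U1 q / U1 q) * A q)
    - (Dt X q + 3 * Dx (Dx X) q * A q) / Dt \<tau> q"
proof -
  have nz: "Dx X q \<noteq> 0" "Dt \<tau> q \<noteq> 0" "U1 q \<noteq> 0" using nonzero[OF assms] nondegenerate(2)[OF assms] by auto
  have "c1 q = U1 q * (Dx X q * B q - 3 * Dx (Dx X) q * A q - Dt X q - Dt \<tau> q * B' (\<tau> q, X q)) - 2 * Dx X q * Dx U1 q * A q"
    using nz unfolding c1_def Dx_\<psi>[OF assms] by (simp add: \<psi>_def b_def field_simps)
  also have "\<dots> = U1 q * Dt \<tau> q * (Dx X q / Dt \<tau> q * (B q - 2 * (Dx U1 q / U1 q) * A q)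
      - (Dt X q + 3 * Dx (Dx X) q * A q) / Dt \<tau> q - B' (\<tau> q, X q))"
    using nz by (simp add: field_simps)
  finally show ?thesis using nz by auto
qed

text \<open>Since \<open>c1\<close> vanishes on all of \<open>K\<close>, the formula it gives for
  \<open>b q * \<psi> q\<close> may be differentiated in x. This replaces the only part of
  \<open>c0\<close> that contains \<open>b\<close> and leaves the adjoint equation.\<close>

lemma c0_eq:
  assumes c1: "\<And>q. q \<in> K \<Longrightarrow> c1 q = 0" and q: "q \<in> K"
  shows "c0 q = Dt \<psi> q + A q * Dx (Dx \<psi>) q - B q * Dx \<psi> q"
proof -
  have "b q * \<psi> q = \<psi> q * B q - 2 * (Dx \<psi> q * A q)" if "q \<in> K" for q
    using c1[OF that] by (simp add: c1_def)
  from dird_cong[OF sets(1) q this]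
  have "Dx (\<lambda>q. b q * \<psi> q) q = Dx (\<lambda>q. \<psi> q * B q - 2 * (Dx \<psi> q * A q)) q" .
  moreover have "Dx (\<lambda>q. \<psi> q * B q - 2 * (Dx \<psi> q * A q)) q = Dx (\<lambda>q. \<psi> q * B q) q - Dx (\<lambda>q. 2 * (Dx \<psi> q * A q)) q"
    by (intro dird_diff smooth_on_differentiable[of K] smooth_on_mult smooth_on_const smooth_on_dird smooth smooth_\<psi> sets q)
  moreover have "Dx (\<lambda>q. 2 * (Dx \<psi> q * A q)) q = 2 * Dx (\<lambda>q. Dx \<psi> q * A q) q"
    by (intro dird_bounded_linear[OF bounded_linear_mult_right] smooth_on_differentiable[of K] smooth_on_mult
        smooth_on_dird smooth smooth_\<psi> sets q)
  ultimately show ?thesis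
    unfolding c0_def dird_mult_smooth[OF smooth_b smooth_\<psi> q] dird_mult_smooth[OF smooth_\<psi> smooth(6) q]
      dird_mult_smooth[OF smooth_on_dird[OF smooth_\<psi>] smooth(5) q]
    by (simp add: algebra_simps)
qed

text \<open>The factor \<open>\<psi>\<close> in front of \<open>f\<close> produces the terms with
  \<open>c1\<close> and \<open>c0\<close>, while \<open>U0\<close> contributes \<open>r\<close>,
  which is independent of \<open>f\<close>.\<close>

lemma fp_residual_affine:
  assumes S: "open S" "S \<subseteq> K" "smooth_on S f" "q \<in> S"
  shows "fp_residual A b (\<lambda>q. Dx X q * (U1 q * f q + U0 q)) q =
    \<psi> q * fp_residual A B f q + Dx f q * c1 q + f q * c0 q + r q"
proof -
  note s = smooth_on_subset[OF _ S(2)]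
  have "fp_residual A b (\<lambda>q. Dx X q * (U1 q * f q + U0 q)) q = fp_residual A b (\<lambda>q. \<psi> q * f q + Dx X q * U0 q) q"
    by (rule fp_residual_cong[OF S(1,4)]) (simp add: \<psi>_def algebra_simps)
  also have "\<dots> = fp_residual A b (\<lambda>q. \<psi> q * f q) q + r q"
    unfolding r_def
    by (intro fp_residual_add[OF S(1) _ _ S(4)] smooth_on_mult[OF S(1)] S(3) s[OF smooth_\<psi>] s[OF smooth(4)]
        s[OF smooth_on_dird[OF smooth(2)]])
  finally show ?thesis
    using fp_residual_mult[OF S(1) s[OF smooth_\<psi>] S(3,4), of A b B] by (simp add: c1_def c0_def)
qed

text \<open>\<open>Dx X q * U0 q\<close> is \<open>\<psi> q\<close> times the quotient of
  \<open>U0\<close> by \<open>U1\<close>, so the product formula applies to it as well, again with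
  brackets \<open>c1\<close> and \<open>c0\<close>.\<close>

lemma r_eq:
  assumes "q \<in> K" "c1 q = 0" "c0 q = 0"
  shows "r q = \<psi> q * fp_residual A B (\<lambda>q. U0 q / U1 q) q"
proof -
  have "r q = fp_residual A b (\<lambda>q. \<psi> q * (U0 q / U1 q)) q"
    unfolding r_def using nondegenerate(2)
    by (intro fp_residual_cong[OF sets(1) assms(1)]) (simp add: \<psi>_def)
  then show ?thesis
    using fp_residual_mult[OF sets(1) smooth_\<psi> smooth_quotient assms(1), of A b B] assms(2,3)
    by (simp add: c1_def c0_def)
qed

text \<open>The identity on which both implications rest: the change of variables followed by the
  product formula, with the image function \<open>g\<close> expressed through
  \<open>f\<close>.\<close>

lemma fp_residual_target:
  assumes S: "open S" "S \<subseteq> K" "smooth_on S f" "q \<in> S"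
    and S': "open S'" "S' \<subseteq> D'" "smooth_on S' g" "\<And>q. q \<in> S \<Longrightarrow> (\<tau> q, X q) \<in> S'"
    and g: "\<And>q. q \<in> S \<Longrightarrow> g (\<tau> q, X q) = U1 q * f q + U0 q"
    and A': "\<And>q. q \<in> K \<Longrightarrow> Dt \<tau> q * A' (\<tau> q, X q) = (Dx X q)\<^sup>2 * A q"
  shows "Dt \<tau> q * Dx X q * fp_residual A' B' g (\<tau> q, X q)
    = \<psi> q * fp_residual A B f q + Dx f q * c1 q + f q * c0 q + r q"
proof -
  note s = smooth_on_subset[OF _ S(2)]
  have K: "q \<in> K" if "q \<in> S" for q using that S(2) by blast
  have "Dt \<tau> q * Dx X q * fp_residual A' B' g (\<tau> q, X q) = fp_residual A b (\<lambda>q. Dx X q * g (\<tau> q, X q)) q"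
  proof (rule fp_residual_transform[OF S(1) s[OF smooth_\<tau>] s[OF smooth(2)] s[OF smooth(5)] s[OF smooth_b] S(4) S'(1)
        smooth_on_subset[OF smooth(7) S'(2)] smooth_on_subset[OF smooth(8) S'(2)] S'(3,4)])
    show "Dx X q \<noteq> 0" by (rule nonzero(2)[OF K[OF S(4)]])
    show "Dx \<tau> q = 0" "Dt \<tau> q * A' (\<tau> q, X q) = (Dx X q)\<^sup>2 * A q"
      "b q * Dx X q = Dx (Dx X) q * A q + Dt \<tau> q * B' (\<tau> q, X q) + Dt X q" if "q \<in> S" for q
      using \<tau>_derivatives(2)[OF K[OF that]] A'[OF K[OF that]] nonzero(2)[OF K[OF that]] by (simp_all add: b_def)
  qed
  also have "\<dots> = fp_residual A b (\<lambda>q. Dx X q * (U1 q * f q + U0 q)) q"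
    by (rule fp_residual_cong[OF S(1,4)]) (simp only: g)
  finally show ?thesis unfolding fp_residual_affine[OF S] .
qed

lemma pd_\<psi>:
  assumes q: "q \<in> K"
  shows "pd_t (\<lambda>q. pd_x X q * U1 q) q = Dt \<psi> q" "pd_x (\<lambda>q. pd_x X q * U1 q) q = Dx \<psi> q"
    "pd_x (pd_x (\<lambda>q. pd_x X q * U1 q)) q = Dx (Dx \<psi>) q"
proof -
  have e: "pd_x X q * U1 q = \<psi> q" if "q \<in> K" for q
    using pd_smooth(2)[OF sets(1) smooth(2) that] by (simp add: \<psi>_def)
  note d = smooth_on_differentiable[OF smooth_\<psi>]
  show "pd_t (\<lambda>q. pd_x X q * U1 q) q = Dt \<psi> q"
    by (rule pd_t_eq[OF sets(1) q e d[OF q]])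
  have x: "pd_x (\<lambda>q. pd_x X q * U1 q) q = Dx \<psi> q" if "q \<in> K" for q
    by (rule pd_x_eq[OF sets(1) that e d[OF that]])
  show "pd_x (\<lambda>q. pd_x X q * U1 q) q = Dx \<psi> q" by (rule x[OF q])
  show "pd_x (pd_x (\<lambda>q. pd_x X q * U1 q)) q = Dx (Dx \<psi>) q"
    by (rule pd_x_eq[OF sets(1) q x smooth_on_differentiable[OF smooth_on_dird[OF smooth_\<psi>] q]])
qed

text \<open>The conditions match in a fixed order: \<open>c0\<close> becomes the adjoint equation
  once \<open>c1\<close> vanishes on \<open>K\<close>, and \<open>r\<close> becomes the equation for
  the quotient once \<open>c0\<close> vanishes too. Hence \<open>c1\<close> is settled first in
  either direction.\<close>

lemma determining_equations_iff:
  "(\<forall>t x. (t, x) \<in> K \<longrightarrow>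
      deriv T t * pd_x X (t, x) \<noteq> 0 \<and>
      U1 (t, x) \<noteq> 0 \<and>
      pd_t (\<lambda>q. pd_x X q * U1 q) (t, x) =
        - A (t, x) * pd_x (pd_x (\<lambda>q. pd_x X q * U1 q)) (t, x)
        + B (t, x) * pd_x (\<lambda>q. pd_x X q * U1 q) (t, x) \<and>
      fokker_planck_at A B (\<lambda>q. U0 q / U1 q) (t, x) \<and>
      A' (T t, X (t, x)) = (pd_x X (t, x))\<^sup>2 / deriv T t * A (t, x) \<and>
      B' (T t, X (t, x)) =
        pd_x X (t, x) / deriv T t *
          (B (t, x) - 2 * (pd_x U1 (t, x) / U1 (t, x)) * A (t, x))
        - (pd_t X (t, x) + 3 * pd_x (pd_x X) (t, x) * A (t, x)) / deriv T t)
  \<longleftrightarrow> (\<forall>q\<in>K. Dt \<tau> q * A' (\<tau> q, X q) = (Dx X q)\<^sup>2 * A q \<and> c1 q = 0 \<and> c0 q = 0 \<and> r q = 0)"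
  (is "(\<forall>t x. (t, x) \<in> K \<longrightarrow> ?L t x) \<longleftrightarrow> (\<forall>q\<in>K. ?R q)")
proof -
  have B'_iff: "B' (T t, X (t, x)) = pd_x X (t, x) / deriv T t *
          (B (t, x) - 2 * (pd_x U1 (t, x) / U1 (t, x)) * A (t, x))
        - (pd_t X (t, x) + 3 * pd_x (pd_x X) (t, x) * A (t, x)) / deriv T t \<longleftrightarrow> c1 (t, x) = 0"
    if "(t, x) \<in> K" for t x
    using c1_eq_0_iff[OF that] \<tau>_derivatives(1)[OF that] pd_smooth[OF sets(1) smooth(2) that]
      pd_smooth[OF sets(1) smooth(3) that] by (simp add: \<tau>_def)
  have A'_iff: "A' (T t, X (t, x)) = (pd_x X (t, x))\<^sup>2 / deriv T t * A (t, x) \<longleftrightarrow>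
      Dt \<tau> (t, x) * A' (\<tau> (t, x), X (t, x)) = (Dx X (t, x))\<^sup>2 * A (t, x)" if "(t, x) \<in> K" for t x
    using nonzero(1)[OF that] \<tau>_derivatives(1)[OF that] pd_smooth[OF sets(1) smooth(2) that]
    by (simp add: \<tau>_def field_simps)
  have fp_iff: "fokker_planck_at A B (\<lambda>q. U0 q / U1 q) q \<longleftrightarrow> fp_residual A B (\<lambda>q. U0 q / U1 q) q = 0"
    if "q \<in> K" for q
    by (rule fokker_planck_at_iff_residual[OF sets(1) smooth(5,6) smooth_quotient that])
  have LR: "?L t x \<longleftrightarrow> ?R (t, x)" if K: "(t, x) \<in> K" and c1: "\<And>q. q \<in> K \<Longrightarrow> c1 q = 0" for t x
  proof -
    have "c0 (t, x) = 0 \<longleftrightarrow> Dt \<psi> (t, x) = - A (t, x) * Dx (Dx \<psi>) (t, x) + B (t, x) * Dx \<psi> (t, x)"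
      using c0_eq[OF c1 K] by auto
    moreover have "r (t, x) = 0 \<longleftrightarrow> fp_residual A B (\<lambda>q. U0 q / U1 q) (t, x) = 0" if "c0 (t, x) = 0"
      using r_eq[OF K c1[OF K] that] nonzero(3)[OF K] by simp
    moreover have "deriv T t * pd_x X (t, x) \<noteq> 0" "U1 (t, x) \<noteq> 0" using nondegenerate[OF K] by simp_all
    ultimately show ?thesis
      unfolding B'_iff[OF K] A'_iff[OF K] fp_iff[OF K] pd_\<psi>[OF K] using c1[OF K] by blast
  qed
  show ?thesis
  proof
    assume L: "\<forall>t x. (t, x) \<in> K \<longrightarrow> ?L t x"
    have c1: "c1 q = 0" if "q \<in> K" for q
    proof -
      obtain t x where q: "q = (t, x)" by (cases q)
      then show ?thesis using L B'_iff that by blast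
    qed
    show "\<forall>q\<in>K. ?R q"
    proof
      fix q assume K: "q \<in> K"
      obtain t x where q: "q = (t, x)" by (cases q)
      show "?R q" using L LR[OF _ c1] K unfolding q by blast
    qed
  next
    assume R: "\<forall>q\<in>K. ?R q"
    then have c1: "c1 q = 0" if "q \<in> K" for q using that by blast
    show "\<forall>t x. (t, x) \<in> K \<longrightarrow> ?L t x"
      using R LR[OF _ c1] by blast
  qed
qed

end

section \<open>The normal form\<close>

abbreviation tx :: "space \<Rightarrow> real \<times> real" where "tx \<equiv> \<lambda>p. (fst p, fst (snd p))"

lemma proj_tx_eq: "proj_tx N = tx ` N" and proj_t_eq: "proj_t N = fst ` N"
  by (simp_all add: proj_tx_def proj_t_def case_prod_unfold)

lemma in_proj_tx: "(t, x, u) \<in> N \<Longrightarrow> (t, x) \<in> proj_tx N"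
  by (force simp: proj_tx_def)

lemma fst_proj_tx: "q \<in> proj_tx N \<Longrightarrow> fst q \<in> proj_t N"
  by (force simp: proj_tx_def proj_t_def)

lemma open_proj: assumes "open N" shows "open (proj_tx N)" "open (proj_t N)"
proof -
  have "proj_tx N = (\<Union>u. (\<lambda>q. (fst q, snd q, u)) -` N)"
  proof (intro set_eqI iffI)
    fix q assume "q \<in> (\<Union>u. (\<lambda>q. (fst q, snd q, u)) -` N)"
    then show "q \<in> proj_tx N" using in_proj_tx[of "fst q" "snd q"] by auto
  qed (auto simp: proj_tx_def)
  also have "open \<dots>"
    by (intro open_UN ballI open_vimage assms continuous_intros)
  finally show "open (proj_tx N)" .
  show "open (proj_t N)"
    unfolding proj_t_eq by (rule open_image_fst[OF assms])
qed

lemma bounded_linear_tx: "bounded_linear tx"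
  by (intro bounded_linear_Pair bounded_linear_fst bounded_linear_compose[OF bounded_linear_fst bounded_linear_snd])

lemma dird_tx:
  assumes "open N" "\<And>p. p \<in> N \<Longrightarrow> F p = F0 (tx p)" "smooth_on (proj_tx N) F0" "p \<in> N"
  shows "dird v F p = dird (tx v) F0 (tx p)"
proof -
  have "dird v F p = dird v (\<lambda>p. F0 (tx p)) p"
    by (rule dird_cong[OF assms(1,4,2)])
  also have "\<dots> = dird (dird v tx p) F0 (tx p)"
  proof (rule dird_comp)
    show "tx differentiable at p"
      by (rule bounded_linear_imp_differentiable[OF bounded_linear_tx])
    show "F0 differentiable at (tx p)"
      by (rule smooth_on_differentiable[OF assms(3)]) (simp add: proj_tx_eq assms(4))
  qed
  finally show ?thesis unfolding dird_linear_id[OF bounded_linear_tx] .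
qed

section \<open>Sufficiency of the normal form\<close>

context fp_transformation
begin

text \<open>The equations are compared at single points, so a ball in \<open>W\<close> about the
  point of the graph is enough. There the residual identity loses its extra terms and relates the
  two residuals by nonzero factors.\<close>

lemma connects_if_normal_form:
  assumes normal: "\<And>N. open N \<Longrightarrow> convex N \<Longrightarrow> N \<subseteq> W \<Longrightarrow>
      \<exists>(T :: real \<Rightarrow> real) X U1 U0.
         smooth_on (proj_t N) T \<and> smooth_on (proj_tx N) X \<and>
         smooth_on (proj_tx N) U1 \<and> smooth_on (proj_tx N) U0 \<and>
         (\<forall>t x u. (t, x, u) \<in> N \<longrightarrow>
            \<Phi> (t, x, u) = (T t, X (t, x), U1 (t, x) * u + U0 (t, x))) \<and>
         (\<forall>t x. (t, x) \<in> proj_tx N \<longrightarrow>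
            deriv T t * pd_x X (t, x) \<noteq> 0 \<and>
            U1 (t, x) \<noteq> 0 \<and>
            pd_t (\<lambda>q. pd_x X q * U1 q) (t, x) =
              - A (t, x) * pd_x (pd_x (\<lambda>q. pd_x X q * U1 q)) (t, x)
              + B (t, x) * pd_x (\<lambda>q. pd_x X q * U1 q) (t, x) \<and>
            fokker_planck_at A B (\<lambda>q. U0 q / U1 q) (t, x) \<and>
            A' (T t, X (t, x)) = (pd_x X (t, x))\<^sup>2 / deriv T t * A (t, x) \<and>
            B' (T t, X (t, x)) =
              pd_x X (t, x) / deriv T t *
                (B (t, x) - 2 * (pd_x U1 (t, x) / U1 (t, x)) * A (t, x))
              - (pd_t X (t, x) + 3 * pd_x (pd_x X) (t, x) * A (t, x)) / deriv T t)"
  shows "connects_fokker_planck W \<Phi> A B A' B'"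
  unfolding connects_fokker_planck_def
proof (intro allI impI, elim conjE)
  fix S S' f g t x t' x' u'
  assume S: "open S" "open S'" "smooth_on S f" "smooth_on S' g" "graph_over S f \<subseteq> W"
    and im: "\<Phi> ` graph_over S f = graph_over S' g"
    and tx: "(t, x) \<in> S" and \<Phi>tx: "\<Phi> (t, x, f (t, x)) = (t', x', u')"
  have "(t, x, f (t, x)) \<in> W"
    using S(5) tx by (auto simp: graph_over_def)
  then obtain e where e: "e > 0" "ball (t, x, f (t, x)) e \<subseteq> W"
    using open_W openE by blast
  define N where "N = ball (t, x, f (t, x)) e"
  have N: "open N" "convex N" "N \<subseteq> W" "(t, x, f (t, x)) \<in> N"
    using e by (simp_all add: N_def)
  from normal[OF N(1-3)] obtain T0 :: "real \<Rightarrow> real" and X0 U1 U0 where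
    sm: "smooth_on (proj_t N) T0" "smooth_on (proj_tx N) X0" "smooth_on (proj_tx N) U1" "smooth_on (proj_tx N) U0"
    and form: "\<forall>t x u. (t, x, u) \<in> N \<longrightarrow> \<Phi> (t, x, u) = (T0 t, X0 (t, x), U1 (t, x) * u + U0 (t, x))"
    and eqs: "\<forall>t x. (t, x) \<in> proj_tx N \<longrightarrow>
            deriv T0 t * pd_x X0 (t, x) \<noteq> 0 \<and>
            U1 (t, x) \<noteq> 0 \<and>
            pd_t (\<lambda>q. pd_x X0 q * U1 q) (t, x) =
              - A (t, x) * pd_x (pd_x (\<lambda>q. pd_x X0 q * U1 q)) (t, x)
              + B (t, x) * pd_x (\<lambda>q. pd_x X0 q * U1 q) (t, x) \<and>
            fokker_planck_at A B (\<lambda>q. U0 q / U1 q) (t, x) \<and>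
            A' (T0 t, X0 (t, x)) = (pd_x X0 (t, x))\<^sup>2 / deriv T0 t * A (t, x) \<and>
            B' (T0 t, X0 (t, x)) =
              pd_x X0 (t, x) / deriv T0 t *
                (B (t, x) - 2 * (pd_x U1 (t, x) / U1 (t, x)) * A (t, x))
              - (pd_t X0 (t, x) + 3 * pd_x (pd_x X0) (t, x) * A (t, x)) / deriv T0 t"
    by (elim exE conjE) (rule that)
  have KD: "proj_tx N \<subseteq> D" using N(3) domain by (auto simp: proj_tx_eq)
  interpret af: affine_transformation "proj_tx N" D' "proj_t N" T0 X0 U1 U0 A B A' B'
  proof
    show "(T0 (fst q), X0 q) \<in> D'" if q: "q \<in> proj_tx N" for q
    proof -
      obtain u where u: "(fst q, snd q, u) \<in> N" using q by (auto simp: proj_tx_def)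
      then show ?thesis
        using form \<Phi>_eq[of "(fst q, snd q, u)"] in_D'[of "(fst q, snd q, u)"] N(3) by auto
    qed
    show "fst q \<in> proj_t N" if "q \<in> proj_tx N" for q
      by (rule fst_proj_tx[OF that])
    show "deriv T0 (fst q) * pd_x X0 q \<noteq> 0" "U1 q \<noteq> 0" if "q \<in> proj_tx N" for q
      using eqs[rule_format, of "fst q" "snd q"] that unfolding prod.collapse by blast+
  qed (rule sm coefficients open_proj[OF N(1)] smooth_on_subset[OF coefficients(2) KD]
      smooth_on_subset[OF coefficients(3) KD])+
  have det: "\<forall>q\<in>proj_tx N. Dt af.\<tau> q * A' (af.\<tau> q, X0 q) = (Dx X0 q)\<^sup>2 * A q \<and> af.c1 q = 0 \<and> af.c0 q = 0 \<and> af.r q = 0"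
    by (rule af.determining_equations_iff[THEN iffD1, OF eqs])
  define q0 where "q0 = (t, x)"
  \<comment> \<open>The part of \<open>S\<close> over which the graph stays in the ball.\<close>
  define S1 where "S1 = S \<inter> (\<lambda>q. (fst q, snd q, f q)) -` N"
  have "continuous_on S (\<lambda>q. (fst q, snd q, f q))"
    using smooth_on_continuous[OF S(3)] by (intro continuous_intros)
  then have S1: "open S1" "q0 \<in> S1" "S1 \<subseteq> S" "\<And>q. q \<in> S1 \<Longrightarrow> (fst q, snd q, f q) \<in> N"
    using continuous_open_preimage[OF _ S(1) N(1)] tx N(4) by (auto simp: S1_def q0_def)
  have S1K: "S1 \<subseteq> proj_tx N" using in_proj_tx[OF S1(4)] by auto
  have \<Phi>S1: "\<Phi> (fst q, snd q, f q) = (af.\<tau> q, X0 q, U1 q * f q + U0 q)" if "q \<in> S1" for q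
    using form[rule_format, OF S1(4)[OF that]] by (simp add: af.\<tau>_def)
  note g = graph_over_image[OF im subsetD[OF S1(3)] \<Phi>S1]
  have y: "(t', x') = (af.\<tau> q0, X0 q0)" using \<Phi>S1[OF S1(2)] \<Phi>tx by (simp add: q0_def)
  have in': "(af.\<tau> q, X0 q) \<in> S' \<inter> D'" if "q \<in> S1" for q
    using g(1)[OF that that] af.sets(5)[of q] S1K that by (auto simp: af.\<tau>_def)
  \<comment> \<open>Intersecting with \<open>D'\<close> gives an open set on which \<open>g\<close>,
    \<open>A'\<close> and \<open>B'\<close> are all smooth.\<close>
  have oS': "open (S' \<inter> D')" using S(2) coefficients(4) by blast
  have sg: "smooth_on (S' \<inter> D') g" using S(4) smooth_on_subset by blast
  have sf: "smooth_on S1 f" using S(3) S1(3) smooth_on_subset by blast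
  have K: "q0 \<in> proj_tx N" using S1(2) S1K by blast
  have "Dt af.\<tau> q0 * Dx X0 q0 * fp_residual A' B' g (t', x') =
      af.\<psi> q0 * fp_residual A B f q0 + Dx f q0 * af.c1 q0 + f q0 * af.c0 q0 + af.r q0"
    unfolding y
    using af.fp_residual_target[OF S1(1) S1K sf S1(2) oS' _ sg in' g(2)[symmetric]] det by simp
  then have eq: "Dt af.\<tau> q0 * Dx X0 q0 * fp_residual A' B' g (t', x') = af.\<psi> q0 * fp_residual A B f q0"
    using det K by simp
  have "fp_residual A B f q0 = 0 \<longleftrightarrow> fp_residual A' B' g (t', x') = 0"
    using eq af.nonzero[OF K] by auto
  moreover have "fokker_planck_at A B f q0 \<longleftrightarrow> fp_residual A B f q0 = 0"
    by (rule fokker_planck_at_iff_residual[OF S1(1) smooth_on_subset[OF af.smooth(5) S1K]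
        smooth_on_subset[OF af.smooth(6) S1K] sf S1(2)])
  moreover have "fokker_planck_at A' B' g (t', x') \<longleftrightarrow> fp_residual A' B' g (t', x') = 0"
    unfolding y using in'[OF S1(2)]
    by (intro fokker_planck_at_iff_residual[OF oS' smooth_on_subset[OF coefficients(5)]
        smooth_on_subset[OF coefficients(6)] sg]) auto
  ultimately show "fokker_planck_at A B f (t, x) \<longleftrightarrow> fokker_planck_at A' B' g (t', x')"
    by (simp add: q0_def)
qed

end

section \<open>Necessity of the normal form\<close>

context fp_connection
begin

text \<open>Otherwise the u-components of all three gradients would vanish, and three vectors in a
  plane are dependent.\<close>

lemma Su_U_nonzero:
  assumes p: "p \<in> W"
  shows "Su U p \<noteq> 0"
proof
  assume u: "Su U p = 0"
  note T = T_gradient[OF p] and X = X_gradient[OF p]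
  \<comment> \<open>Back substitution: the x-equation determines \<open>\<beta>\<close> because
    \<open>Sx T p\<close> vanishes, and the t-equation then determines
    \<open>\<alpha>\<close>.\<close>
  define \<beta> where "\<beta> = - Sx U p / Sx X p"
  define \<alpha> where "\<alpha> = - (\<beta> * St X p + St U p) / St T p"
  have "(1::real) = 0"
  proof (rule gradients_independent(3)[OF p, of \<alpha> \<beta> 1])
    show "\<alpha> * St T p + \<beta> * St X p + 1 * St U p = 0" using T by (simp add: \<alpha>_def)
    show "\<alpha> * Sx T p + \<beta> * Sx X p + 1 * Sx U p = 0" using T X by (simp add: \<beta>_def)
    show "\<alpha> * Su T p + \<beta> * Su X p + 1 * Su U p = 0" using T X u by simp
  qed
  then show False by simp
qed

text \<open>\<open>T\<close>, \<open>X\<close>, \<open>Su U\<close> and the difference of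
  \<open>U\<close> and u times \<open>Su U\<close> do not vary with u, so over the convex set
  \<open>N\<close> they descend to the functions of the normal form; \<open>T\<close> even descends
  to the t-line. The equations then follow by testing the residual identity on affine
  functions.\<close>

lemma normal_form_if_connects:
  assumes N: "open N" "convex N" "N \<subseteq> W"
  shows "\<exists>(T :: real \<Rightarrow> real) X U1 U0.
         smooth_on (proj_t N) T \<and> smooth_on (proj_tx N) X \<and>
         smooth_on (proj_tx N) U1 \<and> smooth_on (proj_tx N) U0 \<and>
         (\<forall>t x u. (t, x, u) \<in> N \<longrightarrow>
            \<Phi> (t, x, u) = (T t, X (t, x), U1 (t, x) * u + U0 (t, x))) \<and>
         (\<forall>t x. (t, x) \<in> proj_tx N \<longrightarrow>
            deriv T t * pd_x X (t, x) \<noteq> 0 \<and>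
            U1 (t, x) \<noteq> 0 \<and>
            pd_t (\<lambda>q. pd_x X q * U1 q) (t, x) =
              - A (t, x) * pd_x (pd_x (\<lambda>q. pd_x X q * U1 q)) (t, x)
              + B (t, x) * pd_x (\<lambda>q. pd_x X q * U1 q) (t, x) \<and>
            fokker_planck_at A B (\<lambda>q. U0 q / U1 q) (t, x) \<and>
            A' (T t, X (t, x)) = (pd_x X (t, x))\<^sup>2 / deriv T t * A (t, x) \<and>
            B' (T t, X (t, x)) =
              pd_x X (t, x) / deriv T t *
                (B (t, x) - 2 * (pd_x U1 (t, x) / U1 (t, x)) * A (t, x))
              - (pd_t X (t, x) + 3 * pd_x (pd_x X) (t, x) * A (t, x)) / deriv T t)"
proof -
  have W: "p \<in> W" if "p \<in> N" for p using that N(3) by blast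
  have sN: "smooth_on N T" "smooth_on N X" "smooth_on N U"
    using smooth_T smooth_X smooth_U smooth_on_subset[OF _ N(3)] by blast+
  \<comment> \<open>A vector in the kernel of the projection \<open>tx\<close> points in the
    u-direction.\<close>
  have vert: "dird v F p = snd (snd v) * Su F p" if "tx v = 0" "smooth_on N F" "p \<in> N" for v p and F :: "space \<Rightarrow> real"
    using dird_space[OF smooth_on_differentiable[OF that(2,3)], of 0 0 "snd (snd v)"] that(1)
    by (cases v) (simp add: zero_prod_def)
  have lin0: "bounded_linear (\<lambda>y :: real \<times> real. (fst y, snd y, 0 :: real))"
    by (intro bounded_linear_Pair bounded_linear_fst bounded_linear_snd bounded_linear_zero)
  have lin1: "bounded_linear (\<lambda>y :: real. (y, 0 :: real, 0 :: real))"
    by (intro bounded_linear_Pair bounded_linear_ident bounded_linear_zero)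
  obtain T0 where T0: "smooth_on (proj_t N) T0" "\<And>p. p \<in> N \<Longrightarrow> T p = T0 (fst p)"
  proof (rule smooth_descend[OF bounded_linear_fst lin1 _ N(1,2) sN(1)])
    show "dird v T p = 0" if "p \<in> N" "fst v = 0" for p v
      using dird_T_zero(1)[OF W[OF that(1)], of "fst (snd v)" "snd (snd v)"] that(2) by (cases v) simp
  qed (auto simp: proj_t_eq)
  have descend: "\<exists>F0. smooth_on (proj_tx N) F0 \<and> (\<forall>p\<in>N. F p = F0 (tx p))"
    if F: "smooth_on N F" "\<And>p. p \<in> N \<Longrightarrow> Su F p = 0" for F
  proof (rule smooth_descend[OF bounded_linear_tx lin0 _ N(1,2) F(1)])
    show "dird v F p = 0" if "p \<in> N" "tx v = 0" for p v
      using vert[OF that(2) F(1) that(1)] F(2)[OF that(1)] by simp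
  qed (auto simp: proj_tx_eq)
  obtain X0 where X0: "smooth_on (proj_tx N) X0" "\<And>p. p \<in> N \<Longrightarrow> X p = X0 (tx p)"
    using descend[OF sN(2) X_gradient(1)[OF W]] by blast
  obtain U1 where U1: "smooth_on (proj_tx N) U1" "\<And>p. p \<in> N \<Longrightarrow> Su U p = U1 (tx p)"
    using descend[OF smooth_on_dird[OF sN(3)] Su_Su_U[OF W]] by blast
  have uu: "bounded_linear (\<lambda>p :: space. snd (snd p))"
    by (rule bounded_linear_compose[OF bounded_linear_snd bounded_linear_snd])
  have su: "smooth_on N (\<lambda>p. snd (snd p))"
    by (intro smooth_on_snd smooth_on_ident N(1))
  have sh: "smooth_on N (\<lambda>p. U p - Su U p * snd (snd p))"
    by (intro smooth_on_diff smooth_on_mult smooth_on_dird sN su N(1))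
  have "Su (\<lambda>p. U p - Su U p * snd (snd p)) p = 0" if "p \<in> N" for p
  proof -
    have "Su (\<lambda>p. U p - Su U p * snd (snd p)) p = Su U p - Su (\<lambda>p. Su U p * snd (snd p)) p"
      by (intro dird_diff smooth_on_differentiable[of N] smooth_on_mult smooth_on_dird sN su N(1) that)
    then show ?thesis
      unfolding dird_mult_smooth[OF smooth_on_dird[OF sN(3)] su that] dird_linear_id[OF uu]
      by (simp add: Su_Su_U[OF W[OF that]])
  qed
  from descend[OF sh this] obtain U0 where U0: "smooth_on (proj_tx N) U0"
    "\<And>p. p \<in> N \<Longrightarrow> U p - Su U p * snd (snd p) = U0 (tx p)" by blast
  have form: "\<Phi> (t, x, u) = (T0 t, X0 (t, x), U1 (t, x) * u + U0 (t, x))" if "(t, x, u) \<in> N" for t x u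
    using T0(2)[OF that] X0(2)[OF that] U1(2)[OF that] U0(2)[OF that] by (simp add: \<Phi>_eq[of "(t, x, u)"])
  have KD: "proj_tx N \<subseteq> D" using N(3) domain by (auto simp: proj_tx_eq)
  have lift: "\<exists>u. (fst q, snd q, u) \<in> N" if "q \<in> proj_tx N" for q
    using that by (auto simp: proj_tx_def)
  note fstK = fst_proj_tx
  note op = open_proj[OF N(1)]
  have s\<tau>: "smooth_on (proj_tx N) (\<lambda>q. T0 (fst q))"
    by (rule smooth_on_comp[OF op _ T0(1) smooth_on_fst[OF op(1) smooth_on_ident[OF op(1)]]])
      (use fstK in auto)
  have T\<tau>: "St T p = Dt (\<lambda>q. T0 (fst q)) (tx p)" if "p \<in> N" for p
    using dird_tx[OF N(1) _ s\<tau> that, of T] T0(2) by simp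
  have XX: "Sx X p = Dx X0 (tx p)" if "p \<in> N" for p
    using dird_tx[OF N(1) X0(2) X0(1) that] by simp
  interpret af: affine_transformation "proj_tx N" D' "proj_t N" T0 X0 U1 U0 A B A' B'
  proof
    fix q assume q: "q \<in> proj_tx N"
    obtain u where u: "(fst q, snd q, u) \<in> N" using lift[OF q] ..
    note w = W[OF u]
    show "fst q \<in> proj_t N" by (rule fstK[OF q])
    show "(T0 (fst q), X0 q) \<in> D'"
      using in_D'[OF w] T0(2)[OF u] X0(2)[OF u] by simp
    have "deriv T0 (fst q) = St T (fst q, snd q, u)"
      using deriv_eq_Dt(1)[OF smooth_on_differentiable[OF T0(1) fstK[OF q]], of "snd q"] T\<tau>[OF u] by simp
    moreover have "pd_x X0 q = Sx X (fst q, snd q, u)"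
      using pd_smooth(2)[OF op(1) X0(1) q] XX[OF u] by simp
    ultimately show "deriv T0 (fst q) * pd_x X0 q \<noteq> 0"
      using T_gradient(3)[OF w] X_gradient(2)[OF w] by simp
    show "U1 q \<noteq> 0" using Su_U_nonzero[OF w] U1(2)[OF u] by simp
  qed (rule T0(1) X0(1) U1(1) U0(1) coefficients op smooth_on_subset[OF coefficients(2) KD]
      smooth_on_subset[OF coefficients(3) KD])+
  have lead: "Dt af.\<tau> q * A' (af.\<tau> q, X0 q) = (Dx X0 q)\<^sup>2 * A q" if q: "q \<in> proj_tx N" for q
  proof -
    obtain u where u: "(fst q, snd q, u) \<in> N" using lift[OF q] ..
    show ?thesis
      using leading_coefficient[OF W[OF u]] T\<tau>[OF u] XX[OF u] T0(2)[OF u] X0(2)[OF u]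
      by (simp add: af.\<tau>_def[abs_def] mult.commute)
  qed
  have bracket: "\<beta> * af.c1 (t, x) + u * af.c0 (t, x) + af.r (t, x) = 0" if p: "(t, x, u) \<in> N" for t x u \<beta>
  proof -
    define q0 where "q0 = (t, x)"
    have K: "q0 \<in> proj_tx N" using in_proj_tx[OF p] by (simp add: q0_def)
    \<comment> \<open>An affine function through \<open>(t, x, u)\<close> with x-slope
      \<open>\<beta>\<close>; its t-slope is the one that the source equation prescribes when u_xx =
      0. Both residuals then vanish, and with them the remaining terms of the identity.\<close>
    define f where "f = jet q0 u ((2 * Dx A q0 + B q0) * \<beta> + (Dx (Dx A) q0 + Dx B q0) * u) \<beta> 0 0"
    have f: "smooth_on UNIV f" by (simp add: f_def jet_smooth)
    have f0: "f q0 = u" "Dx f q0 = \<beta>" by (simp_all add: f_def jet_0 jet_dird)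
    have p0: "(fst q0, snd q0, f q0) = (t, x, u)" by (simp add: q0_def f0[unfolded q0_def])
    have fW: "(fst q0, snd q0, f q0) \<in> W" using W[OF p] p0 by simp
    have "jacobian (fst q0, snd q0, f q0) (Dt f q0) (Dx f q0) \<noteq> 0"
      using T_gradient[OF fW] X_gradient[OF fW] by (simp add: jacobian_def)
    then obtain S S' g where g: "open S" "open S'" "q0 \<in> S" "smooth_on S' g" "S \<subseteq> D" "S' \<subseteq> D'"
      "\<And>q. q \<in> S \<Longrightarrow> (fst q, snd q, f q) \<in> W"
      "\<And>q. q \<in> S \<Longrightarrow> (T (fst q, snd q, f q), X (fst q, snd q, f q)) \<in> S'"
      "\<And>q. q \<in> S \<Longrightarrow> g (T (fst q, snd q, f q), X (fst q, snd q, f q)) = U (fst q, snd q, f q)"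
      "fp_residual A B f q0 = 0 \<longleftrightarrow>
        fp_residual A' B' g (T (fst q0, snd q0, f q0), X (fst q0, snd q0, f q0)) = 0"
      by (rule connect_graph[OF f fW]) (rule that)
    define S1 where "S1 = S \<inter> (\<lambda>q. (fst q, snd q, f q)) -` N"
    have "continuous_on S (\<lambda>q. (fst q, snd q, f q))"
      using smooth_on_continuous[OF smooth_on_subset[OF f subset_UNIV]] by (intro continuous_intros)
    then have S1: "open S1" "q0 \<in> S1" "S1 \<subseteq> S" "\<And>q. q \<in> S1 \<Longrightarrow> (fst q, snd q, f q) \<in> N"
      using continuous_open_preimage[OF _ g(1) N(1)] g(3) p p0 by (auto simp: S1_def)
    have S1K: "S1 \<subseteq> proj_tx N" using in_proj_tx[OF S1(4)] by auto
    have comp: "T (fst q, snd q, f q) = af.\<tau> q" "X (fst q, snd q, f q) = X0 q"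
      "U (fst q, snd q, f q) = U1 q * f q + U0 q" if "q \<in> S1" for q
      using form[OF S1(4)[OF that]] \<Phi>_eq[of "(fst q, snd q, f q)"] by (simp_all add: af.\<tau>_def)
    have in': "(af.\<tau> q, X0 q) \<in> S'" "g (af.\<tau> q, X0 q) = U1 q * f q + U0 q" if "q \<in> S1" for q
      using g(8,9)[OF subsetD[OF S1(3) that]] comp[OF that] by simp_all
    have src: "fp_residual A B f q0 = 0"
      unfolding fp_residual_def f_def jet_dird_dird by (simp add: jet_dird jet_0)
    then have "fp_residual A' B' g (af.\<tau> q0, X0 q0) = 0"
      using g(10) comp[OF S1(2)] by simp
    moreover have "Dt af.\<tau> q0 * Dx X0 q0 * fp_residual A' B' g (af.\<tau> q0, X0 q0) =
        af.\<psi> q0 * fp_residual A B f q0 + Dx f q0 * af.c1 q0 + f q0 * af.c0 q0 + af.r q0"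
      by (rule af.fp_residual_target[OF S1(1) S1K smooth_on_subset[OF f subset_UNIV] S1(2) g(2,6,4) in' lead])
    ultimately show ?thesis using src f0 by (simp add: q0_def)
  qed
  have "\<forall>q\<in>proj_tx N. Dt af.\<tau> q * A' (af.\<tau> q, X0 q) = (Dx X0 q)\<^sup>2 * A q \<and> af.c1 q = 0 \<and> af.c0 q = 0 \<and> af.r q = 0"
  proof
    fix q assume q: "q \<in> proj_tx N"
    obtain t x where tx: "q = (t, x)" by (cases q)
    obtain u where u: "(t, x, u) \<in> N" using lift[OF q] tx by auto
    \<comment> \<open>Openness of \<open>N\<close> lets u vary over a fixed \<open>(t, x)\<close>.
      Two values of \<open>\<beta>\<close> isolate \<open>c1\<close>, and two values of u separate
      \<open>c0\<close> from \<open>r\<close>.\<close>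
    have "open ((\<lambda>u. (t, x, u)) -` N)"
      by (intro open_vimage N(1) continuous_intros)
    then obtain e where e: "e > 0" "\<And>u'. dist u' u < e \<Longrightarrow> (t, x, u') \<in> N"
      using u unfolding open_dist by auto
    have u': "(t, x, u + e / 2) \<in> N" using e by (simp add: dist_real_def)
    have c1: "af.c1 q = 0" using bracket[OF u, of 0] bracket[OF u, of 1] by (simp add: tx)
    have "u * af.c0 q + af.r q = 0" "(u + e / 2) * af.c0 q + af.r q = 0"
      using bracket[OF u, of 0] bracket[OF u', of 0] by (simp_all add: tx)
    then have "e / 2 * af.c0 q = 0" unfolding distrib_right by linarith
    then have "af.c0 q = 0" using e(1) by simp
    then show "Dt af.\<tau> q * A' (af.\<tau> q, X0 q) = (Dx X0 q)\<^sup>2 * A q \<and> af.c1 q = 0 \<and> af.c0 q = 0 \<and> af.r q = 0"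
      using lead[OF q] c1 \<open>u * af.c0 q + af.r q = 0\<close> by simp
  qed
  note det = af.determining_equations_iff[THEN iffD2, OF this]
  show ?thesis
    by (rule exI[of _ T0], rule exI[of _ X0], rule exI[of _ U1], rule exI[of _ U0])
      (intro conjI T0(1) X0(1) U1(1) U0(1) det allI impI form)
qed

end

text \<open>The normal form is demanded on each open convex part of \<open>W\<close>. There the
  fibres of the projections are convex, so the components descend to single-valued functions of t or
  of \<open>(t, x)\<close>; over a general \<open>W\<close> different sheets may carry different
  such functions.\<close>

theorem proposition30:
  fixes A B A' B' :: "real \<times> real \<Rightarrow> real"
    and D D' :: "(real \<times> real) set"
    and W :: "(real \<times> real \<times> real) set"
    and \<Phi> :: "real \<times> real \<times> real \<Rightarrow> real \<times> real \<times> real"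
  assumes source: "fp_coefficients D A B"
    and target: "fp_coefficients D' A' B'"
    and transformation: "point_transformation W \<Phi>"
    and domain: "proj_tx W \<subseteq> D"
    and codomain: "proj_tx (\<Phi> ` W) \<subseteq> D'"
  shows "connects_fokker_planck W \<Phi> A B A' B' \<longleftrightarrow>
    (\<forall>N. open N \<and> convex N \<and> N \<subseteq> W \<longrightarrow>
      (\<exists>(T :: real \<Rightarrow> real) (X :: real \<times> real \<Rightarrow> real)
        (U1 :: real \<times> real \<Rightarrow> real) (U0 :: real \<times> real \<Rightarrow> real).
         smooth_on (proj_t N) T \<and> smooth_on (proj_tx N) X \<and>
         smooth_on (proj_tx N) U1 \<and> smooth_on (proj_tx N) U0 \<and>
         (\<forall>t x u. (t, x, u) \<in> N \<longrightarrow>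
            \<Phi> (t, x, u) = (T t, X (t, x), U1 (t, x) * u + U0 (t, x))) \<and>
         (\<forall>t x. (t, x) \<in> proj_tx N \<longrightarrow>
            deriv T t * pd_x X (t, x) \<noteq> 0 \<and>
            U1 (t, x) \<noteq> 0 \<and>
            pd_t (\<lambda>q. pd_x X q * U1 q) (t, x) =
              - A (t, x) * pd_x (pd_x (\<lambda>q. pd_x X q * U1 q)) (t, x)
              + B (t, x) * pd_x (\<lambda>q. pd_x X q * U1 q) (t, x) \<and>
            fokker_planck_at A B (\<lambda>q. U0 q / U1 q) (t, x) \<and>
            A' (T t, X (t, x)) = (pd_x X (t, x))\<^sup>2 / deriv T t * A (t, x) \<and>
            B' (T t, X (t, x)) =
              pd_x X (t, x) / deriv T t *
                (B (t, x) - 2 * (pd_x U1 (t, x) / U1 (t, x)) * A (t, x))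
              - (pd_t X (t, x) + 3 * pd_x (pd_x X) (t, x) * A (t, x)) / deriv T t)))"
    (is "?C \<longleftrightarrow> (\<forall>N. ?P N \<longrightarrow> ?Q N)")
proof -
  interpret tr: fp_transformation A B A' B' D D' W \<Phi>
    by unfold_locales (fact assms)+
  show ?thesis
  proof
    assume ?C
    then interpret fp_connection A B A' B' D D' W \<Phi>
      by unfold_locales
    show "\<forall>N. ?P N \<longrightarrow> ?Q N"
      by (intro allI impI normal_form_if_connects) simp_all
  next
    assume normal: "\<forall>N. ?P N \<longrightarrow> ?Q N"
    show ?C
    proof (rule tr.connects_if_normal_form)
      fix N :: "space set"
      assume "open N" "convex N" "N \<subseteq> W"
      then show "?Q N" by (intro normal[THEN spec, THEN mp] conjI)
    qed
  qed
qed

end
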